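(* Let $X$ be a metric space, $r>0$, and let $\mathcal{U}$ be a good numerable cover of $X$ such that for every finite subset $\sigma\subset X$: $\sigma$ is contained in some element of $\mathcal{U}$ iff $\operatorname{Diam}(\sigma)<r$. Then $\operatorname{Rips}(X,r)\simeq X$. Likewise, if $\mathcal{U}$ is a good numerable cover of $X$ such that for every finite $\sigma\subset X$: $\sigma$ is contained in some element of $\mathcal{U}$ iff $\operatorname{Diam}(\sigma)\le r$, then $\overline{\operatorname{Rips}}(X,r)\simeq X$.
   Context: $\operatorname{Rips}(X,r)$ (resp. $\overline{\operatorname{Rips}}(X,r)$) is the simplicial complex with vertex set $X$ whose simplices are finite subsets of diameter $<r$ (resp. $\le r$), with the weak topology. A cover is good if every finite intersection of its members is empty or contractible. A cover $\mathcal{U}$ of $X$ is numerable if there is a locally finite partition of unity on $X$ subordinated to $\mathcal{U}$ (each function has support contained in some member of $\mathcal{U}$). *)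

theory Defs
  imports "HOL-Analysis.Analysis"
begin

definition fdiam :: "('a \<Rightarrow> 'a \<Rightarrow> real) \<Rightarrow> 'a set \<Rightarrow> real" where
  "fdiam d \<sigma> = (if \<sigma> = {} then 0 else Max {d x y | x y. x \<in> \<sigma> \<and> y \<in> \<sigma>})"

definition Rips :: "'a set \<Rightarrow> ('a \<Rightarrow> 'a \<Rightarrow> real) \<Rightarrow> real \<Rightarrow> 'a set set" where
  "Rips X d r = {\<sigma>. finite \<sigma> \<and> \<sigma> \<noteq> {} \<and> \<sigma> \<subseteq> X \<and> fdiam d \<sigma> < r}"

definition closed_Rips :: "'a set \<Rightarrow> ('a \<Rightarrow> 'a \<Rightarrow> real) \<Rightarrow> real \<Rightarrow> 'a set set" where
  "closed_Rips X d r = {\<sigma>. finite \<sigma> \<and> \<sigma> \<noteq> {} \<and> \<sigma> \<subseteq> X \<and> fdiam d \<sigma> \<le> r}"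

definition realization_set :: "'a set set \<Rightarrow> ('a \<Rightarrow> real) set" where
  "realization_set K = {t. (\<forall>v. 0 \<le> t v) \<and> {v. t v \<noteq> 0} \<in> K \<and> (\<Sum>v\<in>{v. t v \<noteq> 0}. t v) = 1}"

text \<open>Closed simplex of \<sigma>: points whose support lies in \<sigma>; it carries the
  Euclidean (= product) topology.\<close>

definition closed_simplex :: "'a set set \<Rightarrow> 'a set \<Rightarrow> ('a \<Rightarrow> real) set" where
  "closed_simplex K \<sigma> = {t \<in> realization_set K. {v. t v \<noteq> 0} \<subseteq> \<sigma>}"

definition weak_open :: "'a set set \<Rightarrow> ('a \<Rightarrow> real) set \<Rightarrow> bool" where
  "weak_open K U \<longleftrightarrow> U \<subseteq> realization_set K \<and>
     (\<forall>\<sigma>\<in>K. openin (top_of_set (closed_simplex K \<sigma>)) (U \<inter> closed_simplex K \<sigma>))"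

lemma istopology_weak_open: "istopology (weak_open K)"
  unfolding istopology_def weak_open_def
proof (intro conjI allI impI ballI)
  fix S T assume "S \<subseteq> realization_set K \<and> (\<forall>\<sigma>\<in>K. openin (top_of_set (closed_simplex K \<sigma>)) (S \<inter> closed_simplex K \<sigma>))"
    and "T \<subseteq> realization_set K \<and> (\<forall>\<sigma>\<in>K. openin (top_of_set (closed_simplex K \<sigma>)) (T \<inter> closed_simplex K \<sigma>))"
  then show "S \<inter> T \<subseteq> realization_set K" by blast
  fix \<sigma> assume s: "\<sigma> \<in> K"
  have "S \<inter> T \<inter> closed_simplex K \<sigma> = (S \<inter> closed_simplex K \<sigma>) \<inter> (T \<inter> closed_simplex K \<sigma>)" by blast
  then show "openin (top_of_set (closed_simplex K \<sigma>)) (S \<inter> T \<inter> closed_simplex K \<sigma>)"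
    using s \<open>S \<subseteq> _ \<and> _\<close> \<open>T \<subseteq> _ \<and> _\<close> by (metis openin_Int)
next
  fix \<K> assume h: "\<forall>S\<in>\<K>. S \<subseteq> realization_set K \<and> (\<forall>\<sigma>\<in>K. openin (top_of_set (closed_simplex K \<sigma>)) (S \<inter> closed_simplex K \<sigma>))"
  then show "\<Union>\<K> \<subseteq> realization_set K" by blast
  fix \<sigma> assume s: "\<sigma> \<in> K"
  have "\<Union>\<K> \<inter> closed_simplex K \<sigma> = \<Union>((\<lambda>S. S \<inter> closed_simplex K \<sigma>) ` \<K>)" by blast
  then show "openin (top_of_set (closed_simplex K \<sigma>)) (\<Union>\<K> \<inter> closed_simplex K \<sigma>)"
    using h s by (metis (no_types, lifting) imageE openin_Union)
qed

definition realization :: "'a set set \<Rightarrow> ('a \<Rightarrow> real) topology" where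
  "realization K = topology (weak_open K)"

definition is_cover :: "'a set \<Rightarrow> 'a set set \<Rightarrow> bool" where
  "is_cover X \<U> \<longleftrightarrow> (\<forall>U\<in>\<U>. U \<subseteq> X) \<and> \<Union>\<U> = X"

definition good_cover :: "'a topology \<Rightarrow> 'a set set \<Rightarrow> bool" where
  "good_cover T \<U> \<longleftrightarrow> is_cover (topspace T) \<U> \<and>
     (\<forall>\<F>. finite \<F> \<and> \<F> \<noteq> {} \<and> \<F> \<subseteq> \<U> \<longrightarrow>
        \<Inter>\<F> = {} \<or> contractible_space (subtopology T (\<Inter>\<F>)))"

definition fsupport :: "'a topology \<Rightarrow> ('a \<Rightarrow> real) \<Rightarrow> 'a set" where
  "fsupport T \<phi> = T closure_of {x \<in> topspace T. \<phi> x \<noteq> 0}"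

definition numerable_cover :: "'a topology \<Rightarrow> 'a set set \<Rightarrow> bool" where
  "numerable_cover T \<U> \<longleftrightarrow> is_cover (topspace T) \<U> \<and>
     (\<exists>\<Phi> :: ('a \<Rightarrow> real) set.
        (\<forall>\<phi>\<in>\<Phi>. continuous_map T euclideanreal \<phi> \<and> (\<forall>x\<in>topspace T. 0 \<le> \<phi> x \<and> \<phi> x \<le> 1)) \<and>
        (\<forall>x\<in>topspace T. \<exists>V. openin T V \<and> x \<in> V \<and>
             finite {\<phi>\<in>\<Phi>. \<exists>y\<in>V. \<phi> y \<noteq> 0}) \<and>
        (\<forall>x\<in>topspace T. (\<Sum>\<phi>\<in>{\<phi>\<in>\<Phi>. \<phi> x \<noteq> 0}. \<phi> x) = 1) \<and>
        (\<forall>\<phi>\<in>\<Phi>. \<exists>U\<in>\<U>. fsupport T \<phi> \<subseteq> U))"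

end

(* Both the Rips complex and the nerve of the cover come from one relation, "x lies in U", read in its
   two directions, so Dowker duality and the nerve theorem together give the claim.  Every map needed
   has an explicit formula.  For a weight t, sd t lists the barycentric coordinates of t in the first
   subdivision; its support is the chain of superlevel sets of t.  Choosing a common witness for every
   superlevel set gives the maps of Dowker duality.  For the nerve theorem, a point of the nerve is sent
   to the space by running the contractions of the intersections along its chain of superlevel sets, each
   for a time given by its coordinate; running them from x itself, with times scaled down to 0, deforms
   the identity.  Homotopies into a complex are linear; they pass through core t, a weight continuous in t and supported in
   all the dominant superlevel sets of t. *)
theory Submission
  imports Defs
begin

section \<open>Finitely supported weights\<close>

text \<open>A straight-line homotopy into a complex needs the supports of its two ends to lie in a
  common simplex. In general neither \<open>t\<close> and its image under a Dowker round trip, nor a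
  nerve point and its image under the round trip through the space, have this property: vertices
  that occur only in superlevel sets of small weight share no witness with the image. Keeping only
  the dominant superlevel sets removes them. The ratio one half that defines "dominant" could be any
  number strictly between 0 and 1. Above 0, a set that meets the threshold still has positive
  \<open>sd\<close>, so it is a genuine superlevel set inside the support; below 1,
  \<open>step\<close> has room to grow continuously from 0 at the threshold to 1 at the maximum. Two
  obstacles shape the rest. The weak topology is finer than coordinatewise convergence, so maps into
  a realization are given by families whose supports are locally bounded by a finite set. The
  members of the cover may be neither open nor closed, so the maps back to the space are pasted
  along closed conditions on coordinates.\<close>

definition spt :: "('v \<Rightarrow> real) \<Rightarrow> 'v set" where
  "spt t = {v. t v \<noteq> 0}"

definition weight :: "('v \<Rightarrow> real) \<Rightarrow> bool" where
  "weight t \<longleftrightarrow> finite (spt t) \<and> spt t \<noteq> {} \<and> (\<forall>v. 0 \<le> t v)"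

text \<open>Only values on the support enter, which keeps the maximum finite for an infinite
  \<open>S\<close>; the inserted 0 is the value when \<open>S\<close> misses the support. For a
  finitely supported nonnegative \<open>t\<close> this is the supremum over \<open>S\<close>, with 0
  for the empty set.\<close>

definition mx :: "('v \<Rightarrow> real) \<Rightarrow> 'v set \<Rightarrow> real" where
  "mx t S = Max (insert 0 (t ` (S \<inter> spt t)))"

text \<open>The length of the interval of thresholds \<open>c > 0\<close> with \<open>\<sigma> = {v. c \<le> t v}\<close>: up to scaling,
  the barycentric coordinates of \<open>t\<close> in the first barycentric subdivision.\<close>

definition sd :: "('v \<Rightarrow> real) \<Rightarrow> 'v set \<Rightarrow> real" where
  "sd t \<sigma> = (if finite \<sigma> \<and> \<sigma> \<noteq> {} then max 0 (Min (t ` \<sigma>) - mx t (- \<sigma>)) else 0)"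

text \<open>Fibres are combined by maximum and not by sum: the image of a heaviest vertex is then
  again a heaviest vertex. With sums, several lighter vertices with a common image could overtake
  it. \<open>dowker_map_homotopy_inverse\<close> rests on this.\<close>

definition push :: "('v \<Rightarrow> 'w) \<Rightarrow> ('v \<Rightarrow> real) \<Rightarrow> 'w \<Rightarrow> real" where
  "push \<beta> q b = mx q {x. \<beta> x = b}"

definition normalise :: "('v \<Rightarrow> real) \<Rightarrow> 'v \<Rightarrow> real" where
  "normalise q v = q v / sum q (spt q)"

text \<open>A continuous choice of a weight supported in every \<open>\<sigma>\<close> for which \<open>sd t \<sigma>\<close> is at least
  half of its maximum.\<close>

definition core :: "('v \<Rightarrow> real) \<Rightarrow> 'v \<Rightarrow> real" where
  "core t v = max 0 (mx (sd t) UNIV / 2 - mx (sd t) {\<sigma>. v \<notin> \<sigma>})"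

lemma mx_nonneg: "finite (spt t) \<Longrightarrow> 0 \<le> mx t S"
  by (simp add: mx_def)

lemma mx_ge:
  assumes "finite (spt t)" "v \<in> S" shows "t v \<le> mx t S"
proof (cases "t v = 0")
  case True then show ?thesis using mx_nonneg[OF assms(1)] by simp
next
  case False then show ?thesis using assms by (auto simp: mx_def spt_def)
qed

lemma mx_attained:
  assumes "finite (spt t)" "mx t S \<noteq> 0"
  obtains v where "v \<in> S" "t v = mx t S"
proof -
  have "mx t S \<in> insert 0 (t ` (S \<inter> spt t))"
    unfolding mx_def by (rule Max_in) (use assms in auto)
  then show ?thesis using assms that by auto
qed

lemma mx_least:
  assumes "finite (spt t)" "0 \<le> c" "\<And>v. v \<in> S \<Longrightarrow> t v \<le> c"
  shows "mx t S \<le> c"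
  using assms mx_attained[of t S] by (metis)

text \<open>Trades the support, which varies with \<open>t\<close>, for a fixed finite set; this is
  how \<open>mx\<close> becomes a finite maximum of continuous functions in
  \<open>fin_family_mx\<close>.\<close>

lemma mx_superset:
  assumes "finite A" "spt t \<subseteq> A" "\<And>v. 0 \<le> t v"
  shows "mx t S = Max (insert 0 (t ` (S \<inter> A)))"
proof (rule antisym)
  show "mx t S \<le> Max (insert 0 (t ` (S \<inter> A)))"
    unfolding mx_def using assms by (intro Max_mono) auto
  have "finite (spt t)" using assms finite_subset by auto
  then show "Max (insert 0 (t ` (S \<inter> A))) \<le> mx t S"
    using assms(1) by (auto simp: mx_ge mx_nonneg)
qed

lemma mx_UNIV_pos:
  assumes "weight t" shows "0 < mx t UNIV"
proof -
  obtain v where "t v \<noteq> 0" using assms by (auto simp: weight_def spt_def)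
  then have "0 < t v" using assms by (simp add: weight_def order_less_le)
  also have "t v \<le> mx t UNIV" using assms by (simp add: weight_def mx_ge)
  finally show ?thesis .
qed

lemma weight_max_exists:
  assumes "weight t"
  obtains v where "t v = mx t UNIV" "\<And>w. t w \<le> t v" "v \<in> spt t"
proof -
  have "finite (spt t)" using assms by (simp add: weight_def)
  then obtain v where v: "t v = mx t UNIV"
    using mx_UNIV_pos[OF assms] by (metis mx_attained less_irrefl)
  moreover have "t w \<le> t v" for w using v \<open>finite (spt t)\<close> by (simp add: mx_ge)
  moreover have "v \<in> spt t" using v mx_UNIV_pos[OF assms] by (auto simp: spt_def)
  ultimately show ?thesis using that by blast
qed

section \<open>Superlevel sets and their weights\<close>

lemma sd_nonneg: "0 \<le> sd t \<sigma>"
  by (simp add: sd_def)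

lemma sd_finite: "sd t \<sigma> \<noteq> 0 \<Longrightarrow> finite \<sigma> \<and> \<sigma> \<noteq> {}"
  by (auto simp: sd_def split: if_splits)

lemma sd_gap: "sd t \<sigma> \<noteq> 0 \<Longrightarrow> mx t (- \<sigma>) < Min (t ` \<sigma>)"
  unfolding sd_def by (metis diff_gt_0_iff_gt max.absorb1 not_less)

text \<open>A positive gap between the values inside and outside makes \<open>\<sigma>\<close> a
  superlevel set. From this alone follow the chain property and the fact that every maximiser of
  \<open>t\<close> lies in every set of nonzero weight.\<close>

lemma sd_separates:
  assumes "finite (spt t)" "sd t \<sigma> \<noteq> 0" "v \<in> \<sigma>" "w \<notin> \<sigma>"
  shows "t w < t v"
proof -
  have f: "finite \<sigma>" "\<sigma> \<noteq> {}" using assms sd_finite by auto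
  have "mx t (- \<sigma>) < Min (t ` \<sigma>)" by (rule sd_gap[OF assms(2)])
  moreover have "Min (t ` \<sigma>) \<le> t v" using f assms by auto
  moreover have "t w \<le> mx t (- \<sigma>)" using assms by (simp add: mx_ge)
  ultimately show ?thesis by linarith
qed

lemma sd_subset:
  assumes "finite (spt t)" "sd t \<sigma> \<noteq> 0" shows "\<sigma> \<subseteq> spt t"
proof
  fix v assume v: "v \<in> \<sigma>"
  have f: "finite \<sigma>" "\<sigma> \<noteq> {}" using assms sd_finite by auto
  have "mx t (- \<sigma>) < Min (t ` \<sigma>)" by (rule sd_gap[OF assms(2)])
  moreover have "Min (t ` \<sigma>) \<le> t v" using f v by auto
  moreover have "0 \<le> mx t (- \<sigma>)" using assms by (simp add: mx_nonneg)
  ultimately show "v \<in> spt t" by (auto simp: spt_def)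
qed

lemma sd_chain:
  assumes "finite (spt t)" "sd t \<sigma> \<noteq> 0" "sd t \<tau> \<noteq> 0"
  shows "\<sigma> \<subseteq> \<tau> \<or> \<tau> \<subseteq> \<sigma>"
  using sd_separates[OF assms(1,2)] sd_separates[OF assms(1,3)] by (meson less_asym subsetI)

lemma sd_contains_max:
  assumes "finite (spt t)" "sd t \<sigma> \<noteq> 0" "\<And>w. t w \<le> t v"
  shows "v \<in> \<sigma>"
  using sd_finite[OF assms(2)] sd_separates[OF assms(1,2)] assms(3) by (metis equals0I not_le)

lemma sd_spt: "finite (spt t) \<Longrightarrow> spt (sd t) \<subseteq> Pow (spt t)"
  using sd_subset by (auto simp: spt_def)

lemma weight_sd:
  assumes "weight t" shows "weight (sd t)"
proof -
  have fin: "finite (spt t)" using assms by (simp add: weight_def)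
  obtain v where v: "t v = mx t UNIV" "\<And>w. t w \<le> t v" "v \<in> spt t"
    using weight_max_exists[OF assms] by blast
  \<comment> \<open>The set of all maximisers has positive \<open>sd\<close>: its gap reaches from
    the next smaller value, or 0, up to the maximum.\<close>
  define \<sigma> where "\<sigma> = {w. t w = t v}"
  have "\<sigma> \<subseteq> spt t" using v(3) by (auto simp: \<sigma>_def spt_def)
  then have f: "finite \<sigma>" "\<sigma> \<noteq> {}" using fin finite_subset by (auto simp: \<sigma>_def)
  have "t ` \<sigma> = {t v}" by (auto simp: \<sigma>_def)
  then have m: "Min (t ` \<sigma>) = t v" by simp
  have pos: "0 < t v" using v(1) mx_UNIV_pos[OF assms] by simp
  have "mx t (- \<sigma>) < t v"
  proof (cases "mx t (- \<sigma>) = 0")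
    case False
    then obtain w where w: "w \<in> - \<sigma>" "t w = mx t (- \<sigma>)" using fin mx_attained by metis
    then show ?thesis using v(2)[of w] by (auto simp: \<sigma>_def order_less_le)
  qed (use pos in simp)
  then have "sd t \<sigma> \<noteq> 0" using f m by (simp add: sd_def)
  then have "spt (sd t) \<noteq> {}" by (auto simp: spt_def)
  moreover have "finite (spt (sd t))" using sd_spt[OF fin] fin by (meson finite_Pow_iff finite_subset)
  ultimately show ?thesis using sd_nonneg by (auto simp: weight_def)
qed

section \<open>Push-forward, normalisation and the core\<close>

lemma push_spt:
  assumes "weight q" shows "spt (push \<beta> q) = \<beta> ` spt q"
proof -
  have fin: "finite (spt q)" using assms by (simp add: weight_def)
  show ?thesis
  proof (intro equalityI subsetI)
    fix b assume "b \<in> spt (push \<beta> q)"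
    then have "mx q {x. \<beta> x = b} \<noteq> 0" by (simp add: push_def spt_def)
    moreover then obtain x where "\<beta> x = b" "q x = mx q {x. \<beta> x = b}"
      using fin mx_attained by (metis (mono_tags, lifting) mem_Collect_eq)
    ultimately show "b \<in> \<beta> ` spt q" by (auto simp: spt_def)
  next
    fix b assume "b \<in> \<beta> ` spt q"
    then obtain x where x: "\<beta> x = b" "q x \<noteq> 0" by (auto simp: spt_def)
    then have "q x \<le> push \<beta> q b" unfolding push_def using fin by (intro mx_ge) auto
    moreover have "0 < q x" using x assms by (simp add: weight_def order_less_le)
    ultimately show "b \<in> spt (push \<beta> q)" by (auto simp: spt_def)
  qed
qed

lemma weight_push:
  assumes "weight q" shows "weight (push \<beta> q)"
  unfolding weight_def push_spt[OF assms]
  using assms by (simp add: weight_def push_def mx_nonneg)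

lemma weight_total_pos: "weight q \<Longrightarrow> 0 < sum q (spt q)"
  unfolding weight_def by (intro sum_pos) (auto simp: spt_def order_less_le)

lemma normalise_spt: "weight q \<Longrightarrow> spt (normalise q) = spt q"
  using weight_total_pos[of q] by (auto simp: spt_def normalise_def)

lemma weight_normalise: "weight q \<Longrightarrow> weight (normalise q)"
  using normalise_spt[of q] weight_total_pos[of q]
  by (auto simp: weight_def normalise_def divide_nonneg_pos)

text \<open>A maximiser of \<open>t\<close> lies in every set of nonzero \<open>sd\<close>, so the
  maximum over the sets avoiding it is 0 and it survives in the core. Conversely a vertex of the
  core cannot avoid a heaviest set, and that set is contained in \<open>spt t\<close>.\<close>

lemma weight_core:
  assumes "weight t" shows "weight (core t)" and "spt (core t) \<subseteq> spt t"
proof -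
  have fin: "finite (spt t)" using assms by (simp add: weight_def)
  have ws: "weight (sd t)" by (rule weight_sd[OF assms])
  have fins: "finite (spt (sd t))" using ws by (simp add: weight_def)
  obtain \<sigma> where s: "sd t \<sigma> = mx (sd t) UNIV" "\<sigma> \<in> spt (sd t)"
    using weight_max_exists[OF ws] by metis
  show sub: "spt (core t) \<subseteq> spt t"
  proof
    fix v assume "v \<in> spt (core t)"
    then have c: "mx (sd t) {\<sigma>. v \<notin> \<sigma>} < mx (sd t) UNIV / 2"
      by (auto simp: spt_def core_def)
    have "v \<in> \<sigma>"
    proof (rule ccontr)
      assume "v \<notin> \<sigma>"
      then have "sd t \<sigma> \<le> mx (sd t) {\<sigma>. v \<notin> \<sigma>}" using fins by (intro mx_ge) auto
      then show False using c s(1) mx_UNIV_pos[OF ws] by linarith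
    qed
    then show "v \<in> spt t" using s(2) sd_spt[OF fin] by auto
  qed
  obtain v where v: "\<And>w. t w \<le> t v" using weight_max_exists[OF assms] by metis
  have "sd t \<sigma> = 0" if "v \<notin> \<sigma>" for \<sigma>
    using that v sd_contains_max fin by metis
  then have "mx (sd t) {\<sigma>. v \<notin> \<sigma>} \<le> 0" using fins by (intro mx_least) auto
  then have "core t v \<noteq> 0" using mx_UNIV_pos[OF ws] by (simp add: core_def max_def)
  then have "spt (core t) \<noteq> {}" by (auto simp: spt_def)
  moreover have "finite (spt (core t))" using sub fin finite_subset by auto
  ultimately show "weight (core t)" by (auto simp: weight_def core_def)
qed

text \<open>For a vertex outside \<open>\<sigma>\<close> the subtracted maximum is at least
  \<open>sd t \<sigma>\<close>, hence at least the half from which it is subtracted.\<close>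

lemma core_spt_subset:
  assumes "weight t" "2 * sd t \<sigma> \<ge> mx (sd t) UNIV"
  shows "spt (core t) \<subseteq> \<sigma>"
proof
  fix v assume "v \<in> spt (core t)"
  then have c: "mx (sd t) {\<sigma>. v \<notin> \<sigma>} < mx (sd t) UNIV / 2" by (auto simp: spt_def core_def)
  have fins: "finite (spt (sd t))" using weight_sd[OF assms(1)] by (simp add: weight_def)
  show "v \<in> \<sigma>"
  proof (rule ccontr)
    assume "v \<notin> \<sigma>"
    then have "sd t \<sigma> \<le> mx (sd t) {\<sigma>. v \<notin> \<sigma>}" using fins by (intro mx_ge) auto
    then show False using c assms(2) by linarith
  qed
qed

section \<open>Continuous families of weights\<close>

text \<open>The common finite bound \<open>A\<close> makes continuity of the single coordinates
  sufficient for the weak topology, and turns maxima and sums over supports into operations on a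
  fixed finite set.\<close>

definition fin_family :: "'y topology \<Rightarrow> 'v set \<Rightarrow> ('y \<Rightarrow> 'v \<Rightarrow> real) \<Rightarrow> bool" where
  "fin_family Y A a \<longleftrightarrow> finite A \<and> (\<forall>v. continuous_map Y euclideanreal (\<lambda>y. a y v)) \<and>
     (\<forall>y\<in>topspace Y. weight (a y) \<and> spt (a y) \<subseteq> A)"

lemma continuous_map_Max0:
  assumes "finite I" "\<And>i. i \<in> I \<Longrightarrow> continuous_map Y euclideanreal (f i)"
  shows "continuous_map Y euclideanreal (\<lambda>y. Max (insert 0 ((\<lambda>i. f i y) ` I)))"
  using assms
proof (induction I rule: finite_induct)
  case (insert i I)
  have "(\<lambda>y. Max (insert 0 ((\<lambda>j. f j y) ` insert i I)))
      = (\<lambda>y. max (f i y) (Max (insert 0 ((\<lambda>j. f j y) ` I))))"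
    using insert.hyps by (auto simp: fun_eq_iff insert_commute[of 0])
  then show ?case using insert by (simp add: continuous_map_real_max)
qed simp

lemma continuous_map_Min:
  assumes "finite I" "I \<noteq> {}" "\<And>i. i \<in> I \<Longrightarrow> continuous_map Y euclideanreal (f i)"
  shows "continuous_map Y euclideanreal (\<lambda>y. Min ((\<lambda>i. f i y) ` I))"
  using assms
proof (induction I rule: finite_ne_induct)
  case (insert i I)
  then show ?case by (simp add: continuous_map_real_min)
qed simp

lemma fin_family_mx:
  assumes "fin_family Y A a"
  shows "continuous_map Y euclideanreal (\<lambda>y. mx (a y) S)"
proof (rule continuous_map_eq)
  show "continuous_map Y euclideanreal (\<lambda>y. Max (insert 0 ((\<lambda>v. a y v) ` (S \<inter> A))))"
    using assms by (intro continuous_map_Max0) (auto simp: fin_family_def)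
  show "Max (insert 0 ((\<lambda>v. a y v) ` (S \<inter> A))) = mx (a y) S" if "y \<in> topspace Y" for y
    using assms that by (intro mx_superset[symmetric]) (auto simp: fin_family_def weight_def)
qed

lemma fin_family_sd:
  assumes "fin_family Y A a" shows "fin_family Y (Pow A) (\<lambda>y. sd (a y))"
  unfolding fin_family_def
proof (intro conjI allI ballI)
  show "finite (Pow A)" using assms by (simp add: fin_family_def)
  fix \<sigma>
  show "continuous_map Y euclideanreal (\<lambda>y. sd (a y) \<sigma>)"
  proof (cases "finite \<sigma> \<and> \<sigma> \<noteq> {}")
    case True
    have "continuous_map Y euclideanreal (\<lambda>y. Min (a y ` \<sigma>))"
      using True assms by (intro continuous_map_Min) (auto simp: fin_family_def)
    then show ?thesis
      using True fin_family_mx[OF assms]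
      by (simp add: sd_def continuous_map_real_max continuous_map_diff)
  next
    case False
    then have "sd (a y) \<sigma> = 0" for y unfolding sd_def by argo
    then show ?thesis by simp
  qed
next
  fix y assume y: "y \<in> topspace Y"
  then have w: "weight (a y)" "spt (a y) \<subseteq> A" using assms by (auto simp: fin_family_def)
  show "weight (sd (a y))" by (rule weight_sd[OF w(1)])
  show "spt (sd (a y)) \<subseteq> Pow A" using sd_spt[of "a y"] w by (auto simp: weight_def)
qed

lemma fin_family_push:
  assumes "fin_family Y A a" shows "fin_family Y (\<beta> ` A) (\<lambda>y. push \<beta> (a y))"
  unfolding fin_family_def
proof (intro conjI allI ballI)
  show "finite (\<beta> ` A)" using assms by (simp add: fin_family_def)
  show "continuous_map Y euclideanreal (\<lambda>y. push \<beta> (a y) b)" for b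
    unfolding push_def by (rule fin_family_mx[OF assms])
  fix y assume y: "y \<in> topspace Y"
  then have w: "weight (a y)" "spt (a y) \<subseteq> A" using assms by (auto simp: fin_family_def)
  then show "weight (push \<beta> (a y))" "spt (push \<beta> (a y)) \<subseteq> \<beta> ` A"
    using weight_push[of "a y" \<beta>] push_spt[of "a y" \<beta>] by auto
qed

lemma fin_family_core:
  assumes "fin_family Y A a" shows "fin_family Y A (\<lambda>y. core (a y))"
  unfolding fin_family_def
proof (intro conjI allI ballI)
  show "finite A" using assms by (simp add: fin_family_def)
  note c = fin_family_mx[OF fin_family_sd[OF assms]]
  show "continuous_map Y euclideanreal (\<lambda>y. core (a y) v)" for v
    unfolding core_def
    by (intro continuous_map_real_max continuous_map_diff continuous_map_real_divide c) auto
  fix y assume y: "y \<in> topspace Y"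
  then have w: "weight (a y)" "spt (a y) \<subseteq> A" using assms by (auto simp: fin_family_def)
  then show "weight (core (a y))" "spt (core (a y)) \<subseteq> A" using weight_core[of "a y"] by auto
qed

lemma fin_family_normalise:
  assumes "fin_family Y A a" shows "fin_family Y A (\<lambda>y. normalise (a y))"
  unfolding fin_family_def
proof (intro conjI allI ballI)
  show A: "finite A" using assms by (simp add: fin_family_def)
  have tot: "sum (a y) (spt (a y)) = sum (a y) A" if "y \<in> topspace Y" for y
    using assms that by (intro sum.mono_neutral_left) (auto simp: fin_family_def spt_def)
  show "continuous_map Y euclideanreal (\<lambda>y. normalise (a y) v)" for v
  proof (rule continuous_map_eq)
    show "continuous_map Y euclideanreal (\<lambda>y. a y v / sum (a y) A)"
    proof (intro continuous_map_real_divide continuous_map_sum A)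
      fix y assume y: "y \<in> topspace Y"
      then have "0 < sum (a y) (spt (a y))"
        using assms by (intro weight_total_pos) (simp add: fin_family_def)
      then show "sum (a y) A \<noteq> 0" using tot[OF y] by simp
    qed (use assms in \<open>simp_all add: fin_family_def\<close>)
  qed (simp add: normalise_def tot)
  fix y assume y: "y \<in> topspace Y"
  then have w: "weight (a y)" "spt (a y) \<subseteq> A" using assms by (auto simp: fin_family_def)
  then show "weight (normalise (a y))" "spt (normalise (a y)) \<subseteq> A"
    using weight_normalise[of "a y"] normalise_spt[of "a y"] by auto
qed

lemma fin_family_comp:
  assumes "fin_family Y A a" "continuous_map Z Y f"
  shows "fin_family Z A (\<lambda>z. a (f z))"
proof -
  have "continuous_map Z euclideanreal (\<lambda>z. a (f z) v)" for v
    using assms continuous_map_compose[of Z Y f euclideanreal "\<lambda>y. a y v"]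
    by (auto simp: fin_family_def o_def)
  moreover have "f z \<in> topspace Y" if "z \<in> topspace Z" for z
    using assms(2) that continuous_map_image_subset_topspace by fastforce
  ultimately show ?thesis using assms(1) by (auto simp: fin_family_def)
qed

lemma fin_family_convex:
  assumes a: "fin_family Y A a" and b: "fin_family Y B b"
    and c: "continuous_map Y euclideanreal c" "\<And>y. y \<in> topspace Y \<Longrightarrow> 0 \<le> c y \<and> c y \<le> 1"
  shows "fin_family Y (A \<union> B) (\<lambda>y v. (1 - c y) * a y v + c y * b y v)"
  unfolding fin_family_def
proof (intro conjI allI ballI)
  show "finite (A \<union> B)" using a b by (auto simp: fin_family_def)
  show "continuous_map Y euclideanreal (\<lambda>y. (1 - c y) * a y v + c y * b y v)" for v
    using a b c
    by (intro continuous_map_add continuous_map_real_mult continuous_map_diff)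
      (auto simp: fin_family_def)
  fix y assume y: "y \<in> topspace Y"
  let ?m = "\<lambda>v. (1 - c y) * a y v + c y * b y v"
  have w: "weight (a y)" "spt (a y) \<subseteq> A" "weight (b y)" "spt (b y) \<subseteq> B" "0 \<le> c y" "c y \<le> 1"
    using a b y c(2) by (auto simp: fin_family_def)
  have s: "spt ?m \<subseteq> spt (a y) \<union> spt (b y)" by (auto simp: spt_def)
  have nn: "0 \<le> (1 - c y) * a y v" "0 \<le> c y * b y v" for v
    using w by (auto simp: weight_def)
  have "spt ?m \<noteq> {}"
  proof (cases "c y = 0")
    case True then show ?thesis using w by (simp add: weight_def)
  next
    case False
    then obtain v where "c y * b y v \<noteq> 0" using w(3) by (auto simp: weight_def spt_def)
    then have "?m v \<noteq> 0" using nn[of v] by linarith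
    then show ?thesis by (auto simp: spt_def)
  qed
  moreover have "finite (spt ?m)" using s w by (meson finite_UnI finite_subset weight_def)
  moreover have "\<forall>v. 0 \<le> ?m v" using nn by (simp add: add_nonneg_nonneg)
  ultimately show "weight ?m" unfolding weight_def by blast
  show "spt ?m \<subseteq> A \<union> B" using s w by blast
qed

lemma continuous_map_locally:
  assumes "\<And>y. y \<in> topspace Y \<Longrightarrow> \<exists>V. openin Y V \<and> y \<in> V \<and> continuous_map (subtopology Y V) Z f"
  shows "continuous_map Y Z f"
  by (rule pasting_lemma[where I = "{V. openin Y V \<and> continuous_map (subtopology Y V) Z f}"
        and T = "\<lambda>V. V" and f = "\<lambda>_. f"]) (use assms in auto)

text \<open>The bound may change with the neighbourhood, as it does for an infinite but locally
  finite partition of unity.\<close>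

definition loc_fin_family :: "'y topology \<Rightarrow> ('y \<Rightarrow> 'v \<Rightarrow> real) \<Rightarrow> bool" where
  "loc_fin_family Y a \<longleftrightarrow>
     (\<forall>y\<in>topspace Y. \<exists>V A. openin Y V \<and> y \<in> V \<and> fin_family (subtopology Y V) A a)"

lemma fin_imp_loc_fin_family: "fin_family Y A a \<Longrightarrow> loc_fin_family Y a"
  unfolding loc_fin_family_def by (metis openin_topspace subtopology_topspace)

lemma loc_fin_family_comp:
  assumes "loc_fin_family Y a" "continuous_map Z Y f"
  shows "loc_fin_family Z (\<lambda>z. a (f z))"
  unfolding loc_fin_family_def
proof
  fix z assume z: "z \<in> topspace Z"
  then have "f z \<in> topspace Y" using assms(2) continuous_map_image_subset_topspace by fastforce
  then obtain V A where V: "openin Y V" "f z \<in> V" "fin_family (subtopology Y V) A a"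
    using assms(1) unfolding loc_fin_family_def by blast
  let ?V = "{z \<in> topspace Z. f z \<in> V}"
  have "continuous_map (subtopology Z ?V) (subtopology Y V) f"
    using assms(2) by (auto simp: continuous_map_in_subtopology continuous_map_from_subtopology)
  then have "fin_family (subtopology Z ?V) A (\<lambda>z. a (f z))"
    by (rule fin_family_comp[OF V(3)])
  moreover have "openin Z ?V" using assms(2) V(1) by (rule openin_continuous_map_preimage)
  ultimately show "\<exists>V A. openin Z V \<and> z \<in> V \<and> fin_family (subtopology Z V) A (\<lambda>z. a (f z))"
    using z V(2) by blast
qed

lemma loc_fin_family_convex:
  assumes a: "loc_fin_family Y a" and b: "loc_fin_family Y b"
    and c: "continuous_map Y euclideanreal c" "\<And>y. y \<in> topspace Y \<Longrightarrow> 0 \<le> c y \<and> c y \<le> 1"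
  shows "loc_fin_family Y (\<lambda>y v. (1 - c y) * a y v + c y * b y v)"
  unfolding loc_fin_family_def
proof
  fix y assume y: "y \<in> topspace Y"
  obtain V A where V: "openin Y V" "y \<in> V" "fin_family (subtopology Y V) A a"
    using a y unfolding loc_fin_family_def by blast
  obtain W B where W: "openin Y W" "y \<in> W" "fin_family (subtopology Y W) B b"
    using b y unfolding loc_fin_family_def by blast
  let ?YVW = "subtopology Y (V \<inter> W)"
  have "continuous_map ?YVW (subtopology Y V) (\<lambda>y. y)" "continuous_map ?YVW (subtopology Y W) (\<lambda>y. y)"
    by (auto simp: continuous_map_in_subtopology continuous_map_from_subtopology)
  then have "fin_family ?YVW A a" "fin_family ?YVW B b"
    using fin_family_comp[OF V(3)] fin_family_comp[OF W(3)] by auto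
  then have "fin_family ?YVW (A \<union> B) (\<lambda>y v. (1 - c y) * a y v + c y * b y v)"
    using c(2) by (rule fin_family_convex[OF _ _ continuous_map_from_subtopology[OF c(1)]]) auto
  moreover have "openin Y (V \<inter> W)" "y \<in> V \<inter> W" using V W by auto
  ultimately show "\<exists>V A. openin Y V \<and> y \<in> V \<and>
      fin_family (subtopology Y V) A (\<lambda>y v. (1 - c y) * a y v + c y * b y v)"
    by blast
qed

section \<open>The weak topology\<close>

abbreviation unit_interval :: "real topology" where
  "unit_interval \<equiv> top_of_set {0..1}"

definition is_complex :: "'v set set \<Rightarrow> bool" where
  "is_complex K \<longleftrightarrow> (\<forall>\<sigma>\<in>K. finite \<sigma> \<and> \<sigma> \<noteq> {})"

lemma openin_realization: "openin (realization K) = weak_open K"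
  unfolding realization_def by (rule topology_inverse'[OF istopology_weak_open])

lemma in_realization_set:
  "t \<in> realization_set K \<longleftrightarrow> (\<forall>v. 0 \<le> t v) \<and> spt t \<in> K \<and> sum t (spt t) = 1"
  by (simp add: realization_set_def spt_def)

lemma in_closed_simplex: "t \<in> closed_simplex K \<sigma> \<longleftrightarrow> t \<in> realization_set K \<and> spt t \<subseteq> \<sigma>"
  by (simp add: closed_simplex_def spt_def)

lemma weight_realization: "is_complex K \<Longrightarrow> t \<in> realization_set K \<Longrightarrow> weight t"
  by (simp add: weight_def in_realization_set is_complex_def)

lemma topspace_realization [simp]: "topspace (realization K) = realization_set K"
proof -
  have "realization_set K \<inter> closed_simplex K \<sigma> = closed_simplex K \<sigma>" for \<sigma>
    by (auto simp: in_closed_simplex)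
  then have "weak_open K (realization_set K)" unfolding weak_open_def by simp
  then have "openin (realization K) (realization_set K)" by (simp add: openin_realization)
  moreover have "U \<subseteq> realization_set K" if "openin (realization K) U" for U
    using that by (simp add: openin_realization weak_open_def)
  ultimately show ?thesis by (metis openin_subset openin_topspace subset_antisym)
qed

lemma normalise_in_realization:
  assumes "weight q" "spt q \<in> K" shows "normalise q \<in> realization_set K"
proof -
  have "sum (normalise q) (spt q) = sum q (spt q) / sum q (spt q)"
    unfolding normalise_def by (rule sum_divide_distrib[symmetric])
  then show ?thesis
    using weight_total_pos[OF assms(1)] weight_normalise[OF assms(1)] assms
    by (simp add: in_realization_set normalise_spt weight_def)
qed

lemma fin_family_simplex:
  assumes "is_complex K" "\<sigma> \<in> K"
  shows "fin_family (top_of_set (closed_simplex K \<sigma>)) \<sigma> (\<lambda>t. t)"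
  using assms weight_realization[OF assms(1)]
  by (auto simp: fin_family_def is_complex_def in_closed_simplex
      intro: continuous_on_subset[OF continuous_on_product_coordinates])

lemma continuous_map_from_realization:
  assumes "\<And>\<sigma>. \<sigma> \<in> K \<Longrightarrow> continuous_map (top_of_set (closed_simplex K \<sigma>)) Z f"
  shows "continuous_map (realization K) Z f"
  unfolding continuous_map_def
proof (intro conjI allI impI)
  have "f t \<in> topspace Z" if "t \<in> realization_set K" for t
  proof -
    have "spt t \<in> K" "t \<in> closed_simplex K (spt t)"
      using that by (auto simp: in_closed_simplex in_realization_set)
    then show ?thesis using assms[of "spt t"] by (auto simp: continuous_map_def)
  qed
  then show "f \<in> topspace (realization K) \<rightarrow> topspace Z" by simp
  fix U assume U: "openin Z U"
  have "openin (top_of_set (closed_simplex K \<sigma>)) ({t \<in> realization_set K. f t \<in> U} \<inter> closed_simplex K \<sigma>)"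
    if "\<sigma> \<in> K" for \<sigma>
  proof -
    have "{t \<in> realization_set K. f t \<in> U} \<inter> closed_simplex K \<sigma> = {t \<in> closed_simplex K \<sigma>. f t \<in> U}"
      by (auto simp: in_closed_simplex)
    then show ?thesis
      using openin_continuous_map_preimage[OF assms[OF that] U] by simp
  qed
  then show "openin (realization K) {t \<in> topspace (realization K). f t \<in> U}"
    by (auto simp: openin_realization weak_open_def)
qed

text \<open>Since \<open>[0,1]\<close> is locally compact, the tube lemma shows that its product with the weak topology
  again has the weak topology determined by the cells \<open>[0,1] \<times> \<sigma>\<close>.\<close>

lemma continuous_map_from_interval_realization:
  assumes h: "\<And>\<sigma>. \<sigma> \<in> K \<Longrightarrow>
      continuous_map (prod_topology unit_interval (top_of_set (closed_simplex K \<sigma>))) Z h"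
  shows "continuous_map (prod_topology unit_interval (realization K)) Z h"
  unfolding continuous_map_def
proof (intro conjI allI impI)
  have hZ: "h (\<tau>, t) \<in> topspace Z" if "\<tau> \<in> {0..1}" "t \<in> realization_set K" for \<tau> t
  proof -
    have "spt t \<in> K" "t \<in> closed_simplex K (spt t)"
      using that by (auto simp: in_closed_simplex in_realization_set)
    then show ?thesis using h[of "spt t"] that by (auto simp: continuous_map_def Pi_iff)
  qed
  then show "h \<in> topspace (prod_topology unit_interval (realization K)) \<rightarrow> topspace Z" by auto
  fix U assume U: "openin Z U"
  let ?W = "{p \<in> topspace (prod_topology unit_interval (realization K)). h p \<in> U}"
  have "\<exists>O' V. openin unit_interval O' \<and> openin (realization K) V \<and> \<tau> \<in> O' \<and> t \<in> V \<and> O' \<times> V \<subseteq> ?W"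
    if "(\<tau>, t) \<in> ?W" for \<tau> t
  proof -
    have tau: "\<tau> \<in> {0..1}" and t: "t \<in> realization_set K" and hU: "h (\<tau>, t) \<in> U" using that by auto
    have st: "spt t \<in> K" "t \<in> closed_simplex K (spt t)"
      using t by (auto simp: in_closed_simplex in_realization_set)
    have "continuous_map unit_interval Z (h \<circ> (\<lambda>s. (s, t)))"
      by (rule continuous_map_compose[OF _ h[OF st(1)]])
        (use st in \<open>auto intro!: continuous_intros\<close>)
    from openin_continuous_map_preimage[OF this U]
    have op: "openin unit_interval {s \<in> {0..1}. h (s, t) \<in> U}" by simp
    have "\<tau> \<in> {s \<in> {0..1}. h (s, t) \<in> U}" using tau hU by simp
    then obtain e where e: "e > 0" "cball \<tau> e \<inter> {0..1} \<subseteq> {s \<in> {0..1}. h (s, t) \<in> U}"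
      using op unfolding openin_contains_cball by blast
    define J where "J = cball \<tau> e \<inter> {0..1}"
    have J: "compactin unit_interval J"
      by (simp add: J_def compact_Int_closed compactin_subtopology)
    \<comment> \<open>The compact \<open>J\<close> is fixed before any cell is considered. The tube
      found around \<open>J\<close> may depend on the cell, because openness in the weak topology is
      tested cell by cell.\<close>
    define V where "V = {t \<in> realization_set K. \<forall>s\<in>J. h (s, t) \<in> U}"
    have "openin (top_of_set (closed_simplex K \<sigma>)) (V \<inter> closed_simplex K \<sigma>)" if s: "\<sigma> \<in> K" for \<sigma>
    proof (subst openin_subopen, intro ballI)
      let ?P = "prod_topology unit_interval (top_of_set (closed_simplex K \<sigma>))"
      fix t' assume t': "t' \<in> V \<inter> closed_simplex K \<sigma>"
      have W: "openin ?P {p \<in> topspace ?P. h p \<in> U}"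
        by (rule openin_continuous_map_preimage[OF h[OF s] U])
      have t'': "t' \<in> topspace (top_of_set (closed_simplex K \<sigma>))" using t' by simp
      have "J \<times> {t'} \<subseteq> {p \<in> topspace ?P. h p \<in> U}"
        using t' by (auto simp: V_def J_def)
      from tube_lemma_left[OF W J t'' this]
      obtain P Q where PQ: "openin (top_of_set (closed_simplex K \<sigma>)) Q" "J \<subseteq> P" "t' \<in> Q"
        "P \<times> Q \<subseteq> {p \<in> topspace ?P. h p \<in> U}"
        by (elim exE conjE)
      have "Q \<subseteq> V \<inter> closed_simplex K \<sigma>"
      proof
        fix q assume q: "q \<in> Q"
        then have qK: "q \<in> closed_simplex K \<sigma>" using openin_subset[OF PQ(1)] by auto
        moreover have "h (s, q) \<in> U" if "s \<in> J" for s
          using PQ(2,4) q that by blast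
        ultimately show "q \<in> V \<inter> closed_simplex K \<sigma>" by (simp add: V_def in_closed_simplex)
      qed
      then show "\<exists>Q. openin (top_of_set (closed_simplex K \<sigma>)) Q \<and> t' \<in> Q \<and> Q \<subseteq> V \<inter> closed_simplex K \<sigma>"
        using PQ by blast
    qed
    then have "openin (realization K) V" by (auto simp: openin_realization weak_open_def V_def)
    moreover have "t \<in> V" using t e(2) by (auto simp: V_def J_def)
    moreover have "openin unit_interval (ball \<tau> e \<inter> {0..1})"
      unfolding openin_open by (intro exI[of _ "ball \<tau> e"]) auto
    moreover have "(ball \<tau> e \<inter> {0..1}) \<times> V \<subseteq> ?W"
      by (auto simp: V_def J_def)
    moreover have "\<tau> \<in> ball \<tau> e \<inter> {0..1}" using e tau by simp
    ultimately show ?thesis by blast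
  qed
  then show "openin (prod_topology unit_interval (realization K)) ?W"
    unfolding openin_prod_topology_alt by blast
qed

text \<open>On each closed simplex an open set \<open>U\<close> is the trace of an ambient open
  \<open>G \<sigma>\<close>. Since all supports stay in \<open>A\<close>, only the finitely many
  simplices inside \<open>A\<close> must be tested, and a finite intersection of open conditions is
  open.\<close>

lemma continuous_map_into_realization_fin:
  assumes a: "fin_family Y A a" and aK: "\<And>y. y \<in> topspace Y \<Longrightarrow> a y \<in> realization_set K"
  shows "continuous_map Y (realization K) a"
  unfolding continuous_map_def
proof (intro conjI allI impI)
  show "a \<in> topspace Y \<rightarrow> topspace (realization K)" using aK by simp
  fix U assume U: "openin (realization K) U"
  then have "\<forall>\<sigma>\<in>K. \<exists>G. open G \<and> U \<inter> closed_simplex K \<sigma> = closed_simplex K \<sigma> \<inter> G"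
    unfolding openin_realization weak_open_def openin_open by blast
  then obtain G where G: "\<And>\<sigma>. \<sigma> \<in> K \<Longrightarrow> open (G \<sigma>) \<and> U \<inter> closed_simplex K \<sigma> = closed_simplex K \<sigma> \<inter> G \<sigma>"
    by metis
  have A: "finite A" using a by (simp add: fin_family_def)
  have ca: "continuous_map Y euclidean a"
    using a unfolding euclidean_product_topology[symmetric] continuous_map_componentwise_UNIV
    by (simp add: fin_family_def)
  \<comment> \<open>Either \<open>a y\<close> lies in \<open>G \<sigma>\<close>, or its support
    leaves \<open>\<sigma>\<close> and this simplex imposes nothing. At
    \<open>\<sigma> = spt (a y)\<close> only the first option remains, and it gives membership in
    \<open>U\<close>.\<close>
  define W where "W \<sigma> = {y \<in> topspace Y. a y \<in> G \<sigma>} \<union> (\<Union>v\<in>A - \<sigma>. {y \<in> topspace Y. a y v \<in> - {0}})" for \<sigma>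
  have "openin Y (W \<sigma>)" if "\<sigma> \<in> K \<inter> Pow A" for \<sigma>
  proof -
    have "openin Y {y \<in> topspace Y. a y v \<in> - {0}}" for v
      using a by (intro openin_continuous_map_preimage[of Y euclideanreal]) (auto simp: fin_family_def)
    moreover have "openin Y {y \<in> topspace Y. a y \<in> G \<sigma>}"
      using that G by (intro openin_continuous_map_preimage[OF ca]) auto
    ultimately show ?thesis unfolding W_def by (intro openin_Un openin_Union) auto
  qed
  then have "openin Y (topspace Y \<inter> (\<Inter>\<sigma>\<in>K \<inter> Pow A. W \<sigma>))"
    using A by (intro openin_Int_Inter) auto
  moreover have "topspace Y \<inter> (\<Inter>\<sigma>\<in>K \<inter> Pow A. W \<sigma>) = {y \<in> topspace Y. a y \<in> U}"
  proof (intro equalityI subsetI)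
    fix y assume y: "y \<in> topspace Y \<inter> (\<Inter>\<sigma>\<in>K \<inter> Pow A. W \<sigma>)"
    then have r: "a y \<in> realization_set K" and sA: "spt (a y) \<subseteq> A" using aK a by (auto simp: fin_family_def)
    then have s: "spt (a y) \<in> K" "a y \<in> closed_simplex K (spt (a y))"
      by (auto simp: in_realization_set in_closed_simplex)
    have "y \<in> W (spt (a y))" using y s sA by blast
    then have "a y \<in> G (spt (a y))" by (auto simp: W_def spt_def)
    then show "y \<in> {y \<in> topspace Y. a y \<in> U}" using s G y by blast
  next
    fix y assume y: "y \<in> {y \<in> topspace Y. a y \<in> U}"
    then have r: "a y \<in> realization_set K" and sA: "spt (a y) \<subseteq> A" using aK a by (auto simp: fin_family_def)
    have "y \<in> W \<sigma>" if s: "\<sigma> \<in> K" for \<sigma>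
    proof (cases "spt (a y) \<subseteq> \<sigma>")
      case True
      then have "a y \<in> closed_simplex K \<sigma>" using r by (simp add: in_closed_simplex)
      then show ?thesis using G[OF s] y by (auto simp: W_def)
    next
      case False
      then obtain v where "v \<in> spt (a y)" "v \<notin> \<sigma>" by blast
      then show ?thesis using sA y by (auto simp: W_def spt_def)
    qed
    then show "y \<in> topspace Y \<inter> (\<Inter>\<sigma>\<in>K \<inter> Pow A. W \<sigma>)" using y by blast
  qed
  ultimately show "openin Y {y \<in> topspace Y. a y \<in> U}" by simp
qed

lemma continuous_map_into_realization:
  assumes a: "loc_fin_family Y a" and aK: "\<And>y. y \<in> topspace Y \<Longrightarrow> a y \<in> realization_set K"
  shows "continuous_map Y (realization K) a"
proof (rule continuous_map_locally)
  fix y assume "y \<in> topspace Y"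
  then obtain V A where V: "openin Y V" "y \<in> V" "fin_family (subtopology Y V) A a"
    using a unfolding loc_fin_family_def by blast
  then show "\<exists>V. openin Y V \<and> y \<in> V \<and> continuous_map (subtopology Y V) (realization K) a"
    using continuous_map_into_realization_fin[OF V(3)] aK by (metis IntD1 topspace_subtopology)
qed

lemma convex_combination_in_realization:
  assumes K: "is_complex K" and a: "a \<in> realization_set K" and b: "b \<in> realization_set K"
    and u: "spt a \<union> spt b \<in> K" and c: "0 \<le> c" "c \<le> 1"
  shows "(\<lambda>v. (1 - c) * a v + c * b v) \<in> realization_set K"
proof -
  let ?m = "\<lambda>v. (1 - c) * a v + c * b v"
  have nn: "0 \<le> a v" "0 \<le> b v" for v using a b by (auto simp: in_realization_set)
  have fin: "finite (spt a \<union> spt b)" using u K by (auto simp: is_complex_def)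
  \<comment> \<open>The endpoints are separated because there only one of the two supports is left,
    and \<open>is_complex\<close> does not include closure under faces.\<close>
  have "spt ?m = (if c = 0 then spt a else if c = 1 then spt b else spt a \<union> spt b)"
  proof -
    have "?m v = 0 \<longleftrightarrow> a v = 0 \<and> b v = 0" if "c \<noteq> 0" "c \<noteq> 1" for v
      using that c nn[of v] by (simp add: add_nonneg_eq_0_iff)
    then show ?thesis by (auto simp: spt_def)
  qed
  then have "spt ?m \<in> K" using a b u by (auto simp: in_realization_set)
  moreover have "sum ?m (spt ?m) = 1"
  proof -
    have "sum ?m (spt ?m) = sum ?m (spt a \<union> spt b)"
      using fin by (intro sum.mono_neutral_left) (auto simp: spt_def)
    also have "\<dots> = (1 - c) * sum a (spt a \<union> spt b) + c * sum b (spt a \<union> spt b)"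
      by (simp add: sum.distrib sum_distrib_left)
    also have "sum a (spt a \<union> spt b) = sum a (spt a)"
      using fin by (intro sum.mono_neutral_right) (auto simp: spt_def)
    also have "sum b (spt a \<union> spt b) = sum b (spt b)"
      using fin by (intro sum.mono_neutral_right) (auto simp: spt_def)
    finally show ?thesis using a b by (simp add: in_realization_set)
  qed
  ultimately show ?thesis using nn c by (simp add: in_realization_set)
qed

lemma linear_homotopy:
  assumes K: "is_complex K"
    and a: "\<And>\<sigma>. \<sigma> \<in> K \<Longrightarrow> loc_fin_family (top_of_set (closed_simplex K \<sigma>)) a"
      "\<And>t. t \<in> realization_set K \<Longrightarrow> a t \<in> realization_set K"
    and b: "\<And>\<sigma>. \<sigma> \<in> K \<Longrightarrow> loc_fin_family (top_of_set (closed_simplex K \<sigma>)) b"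
      "\<And>t. t \<in> realization_set K \<Longrightarrow> b t \<in> realization_set K"
    and u: "\<And>t. t \<in> realization_set K \<Longrightarrow> spt (a t) \<union> spt (b t) \<in> K"
  shows "homotopic_with (\<lambda>_. True) (realization K) (realization K) a b"
proof -
  let ?h = "\<lambda>p v. (1 - fst p) * a (snd p) v + fst p * b (snd p) v"
  have "continuous_map (prod_topology unit_interval (realization K)) (realization K) ?h"
  proof (rule continuous_map_from_interval_realization, rule continuous_map_into_realization)
    fix \<sigma> assume s: "\<sigma> \<in> K"
    let ?P = "prod_topology unit_interval (top_of_set (closed_simplex K \<sigma>))"
    have "loc_fin_family ?P (\<lambda>p. a (snd p))" "loc_fin_family ?P (\<lambda>p. b (snd p))"
      by (rule loc_fin_family_comp[OF _ continuous_map_snd], rule a b, rule s)+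
    then show "loc_fin_family ?P ?h"
      by (intro loc_fin_family_convex) (auto intro!: continuous_intros)
    show "?h p \<in> realization_set K" if "p \<in> topspace ?P" for p
      using that a b u
      by (intro convex_combination_in_realization[OF K]) (auto simp: in_closed_simplex)
  qed
  then show ?thesis
    unfolding homotopic_with_def
    by (intro exI[of _ ?h] conjI) auto
qed

section \<open>Dowker duality\<close>

text \<open>The Dowker complex of a relation. For membership of points in the sets of a cover it is
  the Vietoris complex of the cover; for the reversed relation it is the nerve.\<close>

definition dowker :: "'a set \<Rightarrow> 'b set \<Rightarrow> ('a \<Rightarrow> 'b \<Rightarrow> bool) \<Rightarrow> 'a set set" where
  "dowker A B R = {\<sigma>. finite \<sigma> \<and> \<sigma> \<noteq> {} \<and> \<sigma> \<subseteq> A \<and> (\<exists>b\<in>B. \<forall>a\<in>\<sigma>. R a b)}"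

definition dowker_map :: "('a set \<Rightarrow> 'b) \<Rightarrow> ('a \<Rightarrow> real) \<Rightarrow> 'b \<Rightarrow> real" where
  "dowker_map \<beta> t = normalise (push \<beta> (sd t))"

lemma is_complex_dowker: "is_complex (dowker A B R)"
  by (auto simp: is_complex_def dowker_def)

lemma dowker_face: "\<sigma> \<in> dowker A B R \<Longrightarrow> \<tau> \<subseteq> \<sigma> \<Longrightarrow> \<tau> \<noteq> {} \<Longrightarrow> \<tau> \<in> dowker A B R"
  unfolding dowker_def using finite_subset by blast

lemma weight_dowker_map: "weight t \<Longrightarrow> weight (dowker_map \<beta> t)"
  by (simp add: dowker_map_def weight_normalise weight_push weight_sd)

lemma spt_dowker_map: "weight t \<Longrightarrow> spt (dowker_map \<beta> t) = \<beta> ` spt (sd t)"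
  by (simp add: dowker_map_def normalise_spt push_spt weight_push weight_sd)

lemma fin_family_dowker_map:
  "fin_family Y A a \<Longrightarrow> fin_family Y (\<beta> ` Pow A) (\<lambda>y. dowker_map \<beta> (a y))"
  unfolding dowker_map_def by (intro fin_family_normalise fin_family_push fin_family_sd)

lemma spt_sd_simplex:
  assumes "t \<in> realization_set (dowker A B R)" "\<sigma> \<in> spt (sd t)"
  shows "\<sigma> \<in> dowker A B R"
proof -
  have "spt t \<in> dowker A B R" using assms(1) by (simp add: in_realization_set)
  moreover have "finite (spt t)" using calculation by (simp add: dowker_def)
  then have "\<sigma> \<subseteq> spt t" "\<sigma> \<noteq> {}" using assms(2) sd_subset[of t \<sigma>] sd_finite[of t \<sigma>] by (auto simp: spt_def)
  ultimately show ?thesis by (rule dowker_face)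
qed

locale dowker_choice =
  fixes A :: "'a set" and B :: "'b set" and R :: "'a \<Rightarrow> 'b \<Rightarrow> bool" and \<beta> :: "'a set \<Rightarrow> 'b"
  assumes choice: "\<sigma> \<in> dowker A B R \<Longrightarrow> \<beta> \<sigma> \<in> B \<and> (\<forall>a\<in>\<sigma>. R a (\<beta> \<sigma>))"
begin

text \<open>A maximiser \<open>a\<close> of \<open>t\<close> lies in every superlevel set, so it is
  related to all the chosen witnesses at once: it is the common witness that makes their set a
  simplex of the dual complex.\<close>

lemma dowker_map_in:
  assumes t: "t \<in> realization_set (dowker A B R)"
  shows "dowker_map \<beta> t \<in> realization_set (dowker B A (\<lambda>b a. R a b))"
proof -
  have w: "weight t" using weight_realization[OF is_complex_dowker t] .
  have fin: "finite (spt t)" using w by (simp add: weight_def)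
  obtain a where a: "\<And>w. t w \<le> t a" "a \<in> spt t" using weight_max_exists[OF w] by metis
  have "a \<in> A" using a(2) t by (auto simp: in_realization_set dowker_def)
  moreover have "R a (\<beta> \<sigma>) \<and> \<beta> \<sigma> \<in> B" if s: "\<sigma> \<in> spt (sd t)" for \<sigma>
  proof -
    have "a \<in> \<sigma>" using sd_contains_max[OF fin _ a(1)] s by (simp add: spt_def)
    then show ?thesis using choice[OF spt_sd_simplex[OF t s]] by blast
  qed
  moreover have "finite (\<beta> ` spt (sd t))" "\<beta> ` spt (sd t) \<noteq> {}"
    using weight_sd[OF w] by (auto simp: weight_def)
  ultimately have "spt (push \<beta> (sd t)) \<in> dowker B A (\<lambda>b a. R a b)"
    by (auto simp: push_spt weight_sd[OF w] dowker_def)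
  then show ?thesis
    unfolding dowker_map_def by (intro normalise_in_realization weight_push weight_sd w)
qed

lemma dowker_map_continuous:
  "continuous_map (realization (dowker A B R)) (realization (dowker B A (\<lambda>b a. R a b))) (dowker_map \<beta>)"
proof (rule continuous_map_from_realization)
  fix \<sigma> assume "\<sigma> \<in> dowker A B R"
  then show "continuous_map (top_of_set (closed_simplex (dowker A B R) \<sigma>))
      (realization (dowker B A (\<lambda>b a. R a b))) (dowker_map \<beta>)"
    using fin_family_dowker_map[OF fin_family_simplex[OF is_complex_dowker]]
    by (intro continuous_map_into_realization fin_imp_loc_fin_family dowker_map_in)
      (auto simp: in_closed_simplex)
qed

end

text \<open>The support of the core is a face of \<open>spt t\<close>, so the straight line from the
  core to \<open>t\<close> stays in \<open>K\<close>; assumption \<open>u\<close> provides the line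
  from the core to \<open>a t\<close>. The supports of \<open>t\<close> and \<open>a t\<close> never
  have to share a simplex.\<close>

lemma homotopic_id_core:
  fixes K :: "'v set set"
  assumes K: "is_complex K" and face: "\<And>\<sigma> \<tau>. \<sigma> \<in> K \<Longrightarrow> \<tau> \<subseteq> \<sigma> \<Longrightarrow> \<tau> \<noteq> {} \<Longrightarrow> \<tau> \<in> K"
    and a: "\<And>\<sigma>. \<sigma> \<in> K \<Longrightarrow> loc_fin_family (top_of_set (closed_simplex K \<sigma>)) a"
      "\<And>t. t \<in> realization_set K \<Longrightarrow> a t \<in> realization_set K"
    and u: "\<And>t. t \<in> realization_set K \<Longrightarrow> spt (core t) \<union> spt (a t) \<in> K"
  shows "homotopic_with (\<lambda>_. True) (realization K) (realization K) a id"
proof -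
  define c :: "('v \<Rightarrow> real) \<Rightarrow> 'v \<Rightarrow> real" where "c t = normalise (core t)" for t
  have spt_c: "spt (c t) = spt (core t)" "spt (core t) \<subseteq> spt t" "spt (core t) \<in> K"
    if "t \<in> realization_set K" for t
  proof -
    have w: "weight t" by (rule weight_realization[OF K that])
    show "spt (c t) = spt (core t)" by (simp add: c_def normalise_spt weight_core[OF w])
    show sub: "spt (core t) \<subseteq> spt t" by (rule weight_core[OF w])
    have "spt (core t) \<noteq> {}" using weight_core(1)[OF w] by (simp add: weight_def)
    then show "spt (core t) \<in> K" using face sub that by (auto simp: in_realization_set)
  qed
  have cK: "c t \<in> realization_set K" if "t \<in> realization_set K" for t
    using spt_c[OF that] weight_core(1)[OF weight_realization[OF K that]]
    unfolding c_def by (intro normalise_in_realization) auto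
  have cfam: "loc_fin_family (top_of_set (closed_simplex K \<sigma>)) c" if "\<sigma> \<in> K" for \<sigma>
    unfolding c_def
    by (rule fin_imp_loc_fin_family[OF fin_family_normalise[OF fin_family_core[OF
            fin_family_simplex[OF K that]]]])
  have "homotopic_with (\<lambda>_. True) (realization K) (realization K) c a"
    by (rule linear_homotopy[OF K cfam cK a]) (simp_all add: spt_c u)
  moreover have "homotopic_with (\<lambda>_. True) (realization K) (realization K) c (\<lambda>t. t)"
  proof (rule linear_homotopy[OF K cfam cK])
    show "loc_fin_family (top_of_set (closed_simplex K \<sigma>)) (\<lambda>t. t)" if "\<sigma> \<in> K" for \<sigma>
      by (rule fin_imp_loc_fin_family[OF fin_family_simplex[OF K that]])
  qed (auto simp: spt_c Un_absorb1 in_realization_set)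
  ultimately show ?thesis
    unfolding id_def by (meson homotopic_with_symD homotopic_with_trans)
qed

text \<open>Let \<open>\<sigma>\<close> be a heaviest superlevel set. The core lies in
  \<open>\<sigma>\<close>, and \<open>\<beta> \<sigma>\<close>, a heaviest vertex of the image, lies
  in every superlevel set \<open>F\<close> of the image, so it is related to each
  \<open>\<alpha> F\<close> too.\<close>

lemma dowker_map_homotopy_inverse:
  assumes "dowker_choice A B R \<beta>" "dowker_choice B A (\<lambda>b a. R a b) \<alpha>"
  shows "homotopic_with (\<lambda>_. True) (realization (dowker A B R)) (realization (dowker A B R))
           (dowker_map \<alpha> \<circ> dowker_map \<beta>) id"
proof (rule homotopic_id_core[OF is_complex_dowker dowker_face])
  interpret b: dowker_choice A B R \<beta> by fact
  interpret a: dowker_choice B A "\<lambda>b a. R a b" \<alpha> by fact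
  let ?K = "dowker A B R"
  show "loc_fin_family (top_of_set (closed_simplex ?K \<sigma>)) (dowker_map \<alpha> \<circ> dowker_map \<beta>)"
    if "\<sigma> \<in> ?K" for \<sigma>
    unfolding o_def
    by (rule fin_imp_loc_fin_family[OF fin_family_dowker_map[OF fin_family_dowker_map[OF
            fin_family_simplex[OF is_complex_dowker that]]]])
  fix t assume t: "t \<in> realization_set ?K"
  then show ab: "(dowker_map \<alpha> \<circ> dowker_map \<beta>) t \<in> realization_set ?K"
    using b.dowker_map_in a.dowker_map_in by auto
  have w: "weight t" by (rule weight_realization[OF is_complex_dowker t])
  let ?q = "dowker_map \<beta> t"
  have qN: "?q \<in> realization_set (dowker B A (\<lambda>b a. R a b))" by (rule b.dowker_map_in[OF t])
  have wq: "weight ?q" by (rule weight_dowker_map[OF w])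
  have finq: "finite (spt ?q)" using wq by (simp add: weight_def)
  have ws: "weight (sd t)" by (rule weight_sd[OF w])
  obtain \<sigma> where s: "sd t \<sigma> = mx (sd t) UNIV" "\<And>\<tau>. sd t \<tau> \<le> sd t \<sigma>" "\<sigma> \<in> spt (sd t)"
    using weight_max_exists[OF ws] by metis
  have sK: "\<sigma> \<in> ?K" by (rule spt_sd_simplex[OF t s(3)])
  text \<open>All points of the new support are related to \<open>\<beta> \<sigma>\<close>, a vertex of maximal weight.\<close>
  have "push \<beta> (sd t) b \<le> push \<beta> (sd t) (\<beta> \<sigma>)" for b
  proof -
    have fs: "finite (spt (sd t))" using ws by (simp add: weight_def)
    have "push \<beta> (sd t) b \<le> sd t \<sigma>"
      unfolding push_def by (rule mx_least[OF fs sd_nonneg]) (rule s)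
    also have "\<dots> \<le> push \<beta> (sd t) (\<beta> \<sigma>)"
      unfolding push_def by (rule mx_ge[OF fs]) simp
    finally show ?thesis .
  qed
  then have max: "?q b \<le> ?q (\<beta> \<sigma>)" for b
    using weight_total_pos[OF weight_push[OF ws, of \<beta>]]
    unfolding dowker_map_def normalise_def by (intro divide_right_mono) auto
  have "spt (core t) \<subseteq> \<sigma>"
    using core_spt_subset[OF w] s(1) mx_UNIV_pos[OF ws] by simp
  moreover have "R (\<alpha> F) (\<beta> \<sigma>)" if F: "F \<in> spt (sd ?q)" for F
  proof -
    have "\<beta> \<sigma> \<in> F" using sd_contains_max[OF finq _ max] F by (simp add: spt_def)
    then show ?thesis using a.choice[OF spt_sd_simplex[OF qN F]] by blast
  qed
  ultimately have rel: "\<forall>a\<in>spt (core t) \<union> \<alpha> ` spt (sd ?q). R a (\<beta> \<sigma>)"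
    using b.choice[OF sK] by auto
  have ab': "\<alpha> ` spt (sd ?q) \<in> ?K"
    using ab by (simp add: in_realization_set spt_dowker_map[OF wq])
  moreover have "spt (core t) \<subseteq> A" "finite (spt (core t))"
    using weight_core[OF w] t by (auto simp: weight_def in_realization_set dowker_def)
  ultimately have "spt (core t) \<union> \<alpha> ` spt (sd ?q) \<in> ?K"
    using rel b.choice[OF sK] by (auto simp: dowker_def)
  then show "spt (core t) \<union> spt ((dowker_map \<alpha> \<circ> dowker_map \<beta>) t) \<in> ?K"
    by (simp add: spt_dowker_map[OF wq])
qed

lemma dowker_choice_some: "dowker_choice A B R (\<lambda>\<sigma>. SOME b. b \<in> B \<and> (\<forall>a\<in>\<sigma>. R a b))"
proof
  fix \<sigma> assume "\<sigma> \<in> dowker A B R"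
  then have "\<exists>b. b \<in> B \<and> (\<forall>a\<in>\<sigma>. R a b)" by (auto simp: dowker_def)
  then show "(SOME b. b \<in> B \<and> (\<forall>a\<in>\<sigma>. R a b)) \<in> B \<and> (\<forall>a\<in>\<sigma>. R a (SOME b. b \<in> B \<and> (\<forall>a\<in>\<sigma>. R a b)))"
    by (rule someI_ex)
qed

theorem dowker_duality:
  "realization (dowker A B R) homotopy_equivalent_space realization (dowker B A (\<lambda>b a. R a b))"
proof -
  note ab = dowker_choice_some[of A B R] and ba = dowker_choice_some[of B A "\<lambda>b a. R a b"]
  show ?thesis
    unfolding homotopy_equivalent_space_def
    using dowker_map_homotopy_inverse[OF ab ba] dowker_map_homotopy_inverse[OF ba ab]
      dowker_choice.dowker_map_continuous[OF ab] dowker_choice.dowker_map_continuous[OF ba]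
    by blast
qed

section \<open>The nerve theorem\<close>

definition nerve :: "'a topology \<Rightarrow> 'a set set \<Rightarrow> 'a set set set" where
  "nerve T \<U> = dowker \<U> (topspace T) (\<lambda>U x. x \<in> U)"

text \<open>Vanishes unless \<open>sd n F\<close> exceeds half of its maximum. Hence the set where \<open>F\<close> contributes has
  its closure inside the set where \<open>sd n F > 0\<close>, although the members of the cover need not be open or
  closed.\<close>

definition step :: "('v \<Rightarrow> real) \<Rightarrow> 'v set \<Rightarrow> real" where
  "step n F = max 0 (2 * sd n F / mx (sd n) UNIV - 1)"

text \<open>The inequality is weak here but strict in the support of \<open>step\<close>. Thus
  "\<open>F\<close> is in \<open>half\<close>" and "\<open>F\<close> is inactive" are both closed
  conditions, and they overlap where equality holds.\<close>

definition half :: "('v \<Rightarrow> real) \<Rightarrow> 'v set set" where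
  "half n = {F. mx (sd n) UNIV \<le> 2 * sd n F}"

lemma step_range: "weight n \<Longrightarrow> 0 \<le> step n F \<and> step n F \<le> 1"
  using mx_UNIV_pos[OF weight_sd, of n] mx_ge[of "sd n" F UNIV] weight_sd[of n]
  by (auto simp: step_def weight_def field_simps)

lemma step_nonzero: "weight n \<Longrightarrow> step n F \<noteq> 0 \<longleftrightarrow> mx (sd n) UNIV < 2 * sd n F"
  using mx_UNIV_pos[OF weight_sd, of n] by (auto simp: step_def field_simps max_def)

text \<open>The scaling of \<open>step\<close> is chosen for this: a heaviest set is contracted for
  the full time 1, and that contraction makes the starting point irrelevant.\<close>

lemma step_one:
  assumes "weight n" obtains F where "step n F = 1"
proof -
  obtain F where "sd n F = mx (sd n) UNIV"
    using weight_max_exists[OF weight_sd[OF assms]] by metis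
  then have "step n F = 1" using mx_UNIV_pos[OF weight_sd[OF assms]] by (simp add: step_def)
  then show ?thesis using that by blast
qed

lemma half_subset: "weight n \<Longrightarrow> half n \<subseteq> spt (sd n)"
  using mx_UNIV_pos[OF weight_sd, of n] by (auto simp: half_def spt_def)

lemma finite_half: "weight n \<Longrightarrow> finite (half n)"
  using half_subset[of n] weight_sd[of n] finite_subset by (auto simp: weight_def)

lemma step_in_half: "weight n \<Longrightarrow> step n F \<noteq> 0 \<Longrightarrow> F \<in> half n"
  by (simp add: step_nonzero half_def)

lemma half_chain: "weight n \<Longrightarrow> F \<in> half n \<Longrightarrow> G \<in> half n \<Longrightarrow> F \<subseteq> G \<or> G \<subseteq> F"
  using half_subset[of n] sd_chain[of n F G] by (auto simp: weight_def spt_def)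

lemma fin_family_step:
  assumes "fin_family Y A n" shows "continuous_map Y euclideanreal (\<lambda>y. step (n y) F)"
proof -
  note s = fin_family_sd[OF assms]
  have "mx (sd (n y)) UNIV \<noteq> 0" if "y \<in> topspace Y" for y
    using mx_UNIV_pos[of "sd (n y)"] s that by (force simp: fin_family_def)
  then show ?thesis
    unfolding step_def using s fin_family_mx[OF s]
    by (intro continuous_map_real_max continuous_map_diff continuous_map_real_divide
        continuous_map_real_mult) (auto simp: fin_family_def)
qed

section \<open>Finite chains as strictly increasing lists\<close>

lemma sorted_subset_list_exists:
  assumes "finite c" "\<And>F G. F \<in> c \<Longrightarrow> G \<in> c \<Longrightarrow> F \<subseteq> G \<or> G \<subseteq> F"
  shows "\<exists>L. sorted_wrt (\<subset>) L \<and> set L = c"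
  using assms
proof (induction c rule: finite_psubset_induct)
  case (psubset c)
  show ?case
  proof (cases "c = {}")
    case False
    then obtain F where F: "F \<in> c" "\<And>G. G \<in> c \<Longrightarrow> G \<subseteq> F \<Longrightarrow> F = G"
      using psubset.hyps finite_has_minimal by metis
    then have "\<exists>L. sorted_wrt (\<subset>) L \<and> set L = c - {F}"
      using psubset.prems by (intro psubset.IH) auto
    then obtain L where L: "sorted_wrt (\<subset>) L" "set L = c - {F}" by blast
    have "F \<subset> G" if "G \<in> set L" for G
      using that L(2) F psubset.prems[of F G] by blast
    then have "sorted_wrt (\<subset>) (F # L)" "set (F # L) = c" using L F by auto
    then show ?thesis by blast
  qed auto
qed

lemma sorted_subset_list_unique:
  assumes "sorted_wrt (\<subset>) L" "sorted_wrt (\<subset>) L'" "set L = set L'"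
  shows "L = L'"
  using assms
proof (induction L arbitrary: L')
  case (Cons F L)
  then obtain G M where L': "L' = G # M" by (cases L') auto
  have "F = G"
    using Cons.prems unfolding L' by (metis insert_iff list.simps(15) psubset_imp_subset
        psubsetE sorted_wrt.simps(2))
  moreover have "F \<notin> set L" "G \<notin> set M" using Cons.prems by (auto simp: L')
  ultimately have "set L = set M" using Cons.prems(3) by (simp add: L' insert_ident)
  then have "L = M" using Cons.prems by (intro Cons.IH) (simp_all add: L')
  then show ?case using \<open>F = G\<close> by (simp add: L')
qed simp

definition chain_list :: "'v set set \<Rightarrow> 'v set list" where
  "chain_list c = (SOME L. sorted_wrt (\<subset>) L \<and> set L = c)"

lemma chain_list:
  assumes "finite c" "\<And>F G. F \<in> c \<Longrightarrow> G \<in> c \<Longrightarrow> F \<subseteq> G \<or> G \<subseteq> F"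
  shows "sorted_wrt (\<subset>) (chain_list c)" "set (chain_list c) = c"
  using someI_ex[OF sorted_subset_list_exists[OF assms]] by (auto simp: chain_list_def)

lemma chain_list_half:
  assumes "weight n"
  shows "sorted_wrt (\<subset>) (chain_list (half n))" "set (chain_list (half n)) = half n"
  using chain_list[OF finite_half[OF assms]] half_chain[OF assms] by blast+

lemma chain_list_eq:
  assumes "sorted_wrt (\<subset>) L" shows "chain_list (set L) = L"
proof -
  have "sorted_wrt (\<subset>) (chain_list (set L)) \<and> set (chain_list (set L)) = set L"
    unfolding chain_list_def by (rule someI[of "\<lambda>M. sorted_wrt (\<subset>) M \<and> set M = set L" L]) (simp add: assms)
  then show ?thesis using assms by (intro sorted_subset_list_unique) auto
qed

section \<open>Contractions composed along a chain of intersections\<close>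

locale contractible_cover =
  fixes T :: "'a topology" and \<U> :: "'a set set"
    and h :: "'a set set \<Rightarrow> real \<times> 'a \<Rightarrow> 'a" and pt :: "'a set set \<Rightarrow> 'a"
  assumes sub: "U \<in> \<U> \<Longrightarrow> U \<subseteq> topspace T"
    and h_cont: "F \<in> nerve T \<U> \<Longrightarrow>
      continuous_map (prod_topology unit_interval (subtopology T (\<Inter>F))) (subtopology T (\<Inter>F)) (h F)"
    and h_0: "F \<in> nerve T \<U> \<Longrightarrow> x \<in> \<Inter>F \<Longrightarrow> h F (0, x) = x"
    and h_1: "F \<in> nerve T \<U> \<Longrightarrow> x \<in> \<Inter>F \<Longrightarrow> h F (1, x) = pt F"
begin

abbreviation "N \<equiv> nerve T \<U>"

text \<open>On an increasing list \<open>foldr\<close> applies the largest family first, whose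
  intersection is the smallest. Each result stays inside the intersections still to come, so
  contractions chosen without any mutual compatibility can be composed. The guard for time 0 skips
  families whose intersection need not contain the point.\<close>

definition flow :: "'a set set list \<Rightarrow> ('a set set \<Rightarrow> real) \<Rightarrow> 'a \<Rightarrow> 'a" where
  "flow L s x = foldr (\<lambda>F y. if s F = 0 then y else h F (s F, y)) L x"

lemma flow_simps [simp]:
  "flow [] s x = x"
  "flow (F # L) s x = (if s F = 0 then flow L s x else h F (s F, flow L s x))"
  by (simp_all add: flow_def)

definition glide :: "('a set set \<Rightarrow> real) \<Rightarrow> 'a \<Rightarrow> 'a" where
  "glide s x = flow (chain_list {F. s F \<noteq> 0}) s x"

lemma flow_filter: "flow (filter (\<lambda>F. s F \<noteq> 0) L) s x = flow L s x"
  by (induction L) auto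

text \<open>Inactive entries are skipped, so any increasing list containing the active families
  gives the same result. Points with different active chains can therefore share one list, as the
  continuity argument requires.\<close>

lemma glide_eq_flow:
  assumes L: "sorted_wrt (\<subset>) L" and s: "{F. s F \<noteq> 0} \<subseteq> set L"
  shows "glide s x = flow L s x"
proof -
  let ?M = "filter (\<lambda>F. s F \<noteq> 0) L"
  have M: "sorted_wrt (\<subset>) ?M" "set ?M = {F. s F \<noteq> 0}"
    using L s by (auto simp: sorted_wrt_filter)
  have "chain_list {F. s F \<noteq> 0} = ?M" using chain_list_eq[OF M(1)] M(2) by simp
  then show ?thesis by (simp add: glide_def flow_filter)
qed

lemma in_topspace: "F \<in> N \<Longrightarrow> x \<in> \<Inter>F \<Longrightarrow> x \<in> topspace T"
  using sub by (fastforce simp: nerve_def dowker_def)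

lemma h_in: "F \<in> N \<Longrightarrow> 0 \<le> \<tau> \<Longrightarrow> \<tau> \<le> 1 \<Longrightarrow> x \<in> \<Inter>F \<Longrightarrow> h F (\<tau>, x) \<in> \<Inter>F"
  using h_cont[of F] in_topspace[of F x] by (force simp: continuous_map_def Pi_iff)

text \<open>\<open>E\<close> is generalised because the induction hypothesis is used with the
  intersection of the head family: the tail consists of larger families with smaller intersections,
  so its flow ends in the domain of the next contraction.\<close>

lemma flow_in:
  assumes "sorted_wrt (\<subset>) L" "\<And>F. F \<in> set L \<Longrightarrow> F \<in> N \<and> 0 \<le> s F \<and> s F \<le> 1 \<and> x \<in> \<Inter>F"
    and "\<And>F. F \<in> set L \<Longrightarrow> \<Inter>F \<subseteq> E" "x \<in> E"
  shows "flow L s x \<in> E"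
  using assms
proof (induction L arbitrary: E)
  case (Cons F L)
  have L: "sorted_wrt (\<subset>) L" and FL: "\<And>G. G \<in> set L \<Longrightarrow> F \<subset> G" using Cons.prems(1) by auto
  have F: "F \<in> N" "0 \<le> s F" "s F \<le> 1" "x \<in> \<Inter>F" "\<Inter>F \<subseteq> E"
    using Cons.prems(2,3)[of F] by auto
  have p: "G \<in> N \<and> 0 \<le> s G \<and> s G \<le> 1 \<and> x \<in> \<Inter>G" if "G \<in> set L" for G
    using Cons.prems(2)[of G] that by simp
  have "flow L s x \<in> \<Inter>F"
  proof (rule Cons.IH[OF L p _ F(4)])
    show "\<Inter>G \<subseteq> \<Inter>F" if "G \<in> set L" for G using FL[OF that] by blast
  qed
  then have hF: "h F (s F, flow L s x) \<in> \<Inter>F" and fE: "flow L s x \<in> E"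
    using h_in[OF F(1-3)] F(5) by blast+
  show ?case
  proof (cases "s F = 0")
    case True then show ?thesis using fE by simp
  next
    case False then show ?thesis using hF F(5) by (simp only: flow_simps if_False subsetD)
  qed
qed simp

text \<open>A full contraction forgets everything that was applied before it.\<close>

lemma flow_start:
  assumes "sorted_wrt (\<subset>) L" "\<And>F. F \<in> set L \<Longrightarrow> F \<in> N \<and> 0 \<le> s F \<and> s F \<le> 1 \<and> x \<in> \<Inter>F \<and> x' \<in> \<Inter>F"
    and "F \<in> set L" "s F = 1"
  shows "flow L s x = flow L s x'"
  using assms
proof (induction L)
  case (Cons G L)
  show ?case
  proof (cases "s G = 1")
    case True
    have L: "sorted_wrt (\<subset>) L" and GL: "\<And>H. H \<in> set L \<Longrightarrow> \<Inter>H \<subseteq> \<Inter>G"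
      using Cons.prems(1) by auto
    have G: "G \<in> N" "x \<in> \<Inter>G" "x' \<in> \<Inter>G" using Cons.prems(2)[of G] by auto
    have p: "H \<in> N \<and> 0 \<le> s H \<and> s H \<le> 1 \<and> x \<in> \<Inter>H \<and> x' \<in> \<Inter>H" if "H \<in> set L" for H
      using Cons.prems(2)[of H] that by simp
    have "flow L s x \<in> \<Inter>G"
      by (rule flow_in[OF L _ GL G(2)]) (use p in blast)+
    moreover have "flow L s x' \<in> \<Inter>G"
      by (rule flow_in[OF L _ GL G(3)]) (use p in blast)+
    ultimately show ?thesis using True h_1[OF G(1)] by simp
  next
    case False
    then have "F \<in> set L" using Cons.prems by auto
    moreover have "sorted_wrt (\<subset>) L" using Cons.prems(1) by simp
    moreover have "G \<in> N \<and> 0 \<le> s G \<and> s G \<le> 1 \<and> x \<in> \<Inter>G \<and> x' \<in> \<Inter>G" if "G \<in> set L" for G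
      using Cons.prems(2)[of G] that by simp
    ultimately have "flow L s x = flow L s x'" using Cons.prems(4) by (intro Cons.IH)
    then show ?thesis by simp
  qed
qed simp

lemma flow_continuous:
  assumes "sorted_wrt (\<subset>) L" "continuous_map Y T p"
    and "\<And>F. F \<in> set L \<Longrightarrow> F \<in> N \<and> continuous_map Y euclideanreal (\<lambda>y. s y F)"
    and "\<And>F y. F \<in> set L \<Longrightarrow> y \<in> topspace Y \<Longrightarrow> 0 \<le> s y F \<and> s y F \<le> 1 \<and> p y \<in> \<Inter>F"
  shows "continuous_map Y T (\<lambda>y. flow L (s y) (p y))"
  using assms
proof (induction L)
  case (Cons F L)
  have F: "F \<in> N" using Cons.prems by simp
  have c: "continuous_map Y T (\<lambda>y. flow L (s y) (p y))"
  proof (rule Cons.IH[OF _ Cons.prems(2)])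
    show "sorted_wrt (\<subset>) L" using Cons.prems(1) by simp
    show "G \<in> N \<and> continuous_map Y euclideanreal (\<lambda>y. s y G)" if "G \<in> set L" for G
      using Cons.prems(3)[of G] that by simp
    show "0 \<le> s y G \<and> s y G \<le> 1 \<and> p y \<in> \<Inter>G" if "G \<in> set L" "y \<in> topspace Y" for G y
      using Cons.prems(4)[of G y] that by simp
  qed
  have L: "sorted_wrt (\<subset>) L" and FL: "\<And>G. G \<in> set L \<Longrightarrow> \<Inter>G \<subseteq> \<Inter>F"
    using Cons.prems(1) by auto
  have i: "flow L (s y) (p y) \<in> \<Inter>F" if "y \<in> topspace Y" for y
  proof (rule flow_in[OF L _ FL])
    show "G \<in> N \<and> 0 \<le> s y G \<and> s y G \<le> 1 \<and> p y \<in> \<Inter>G" if "G \<in> set L" for G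
      using Cons.prems(3,4)[of G] that \<open>y \<in> topspace Y\<close> by simp
    show "p y \<in> \<Inter>F" using Cons.prems(4)[of F] that by simp
  qed
  have "continuous_map Y (prod_topology unit_interval (subtopology T (\<Inter>F))) (\<lambda>y. (s y F, flow L (s y) (p y)))"
    using c i Cons.prems(3,4)[of F]
    by (simp add: continuous_map_paired continuous_map_in_subtopology image_subset_iff Pi_iff)
  from continuous_map_compose[OF this h_cont[OF F]]
  have "continuous_map Y T (\<lambda>y. h F (s y F, flow L (s y) (p y)))"
    by (auto simp: o_def continuous_map_in_subtopology)
  \<comment> \<open>By \<open>h_0\<close> the contraction at time 0 is the identity on the
    intersection, so the guarded definition agrees with the unguarded, visibly continuous
    formula.\<close>
  then show ?case
    by (rule continuous_map_eq) (use i h_0[OF F] in auto)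
qed simp

lemma half_in_nerve: "n \<in> realization_set N \<Longrightarrow> F \<in> half n \<Longrightarrow> F \<in> N"
  unfolding nerve_def
  using half_subset[OF weight_realization[OF is_complex_dowker]] spt_sd_simplex by fast

lemma half_subset_spt:
  assumes "weight n" "F \<in> half n" shows "F \<subseteq> spt n"
  using half_subset[OF assms(1)] sd_subset[of n F] assms by (auto simp: weight_def spt_def)

lemma weight_nerve: "n \<in> realization_set N \<Longrightarrow> weight n"
  unfolding nerve_def by (rule weight_realization[OF is_complex_dowker])

lemma glide_half:
  assumes n: "n \<in> realization_set N" and s: "\<And>F. s F = c * step n F" and c: "0 \<le> c" "c \<le> 1"
  shows "glide s x = flow (chain_list (half n)) s x"
    and "F \<in> set (chain_list (half n)) \<Longrightarrow> F \<in> N \<and> 0 \<le> s F \<and> s F \<le> 1 \<and> \<Inter>(spt n) \<subseteq> \<Inter>F"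
proof -
  note w = weight_nerve[OF n]
  note L = chain_list_half[OF w]
  show "glide s x = flow (chain_list (half n)) s x"
    by (rule glide_eq_flow) (use L step_in_half[OF w] in \<open>auto simp: s\<close>)
  show "F \<in> N \<and> 0 \<le> s F \<and> s F \<le> 1 \<and> \<Inter>(spt n) \<subseteq> \<Inter>F" if "F \<in> set (chain_list (half n))"
    using that L(2) half_in_nerve[OF n] Inter_anti_mono[OF half_subset_spt[OF w, of F]]
      step_range[OF w, of F] c
    by (simp add: s mult_le_one)
qed

text \<open>Some step equals 1, so \<open>flow_start\<close> applies. Hence an arbitrary choice of
  starting point in the map from the nerve is harmless, and the deformation starting from
  \<open>x\<close> itself ends at the same map.\<close>

lemma glide_start:
  assumes n: "n \<in> realization_set N" and "x \<in> \<Inter>(spt n)" "x' \<in> \<Inter>(spt n)"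
  shows "glide (step n) x = glide (step n) x'"
proof -
  note w = weight_nerve[OF n]
  note L = chain_list_half[OF w]
  note g = glide_half[OF n, of "step n" 1, simplified]
  obtain F where F: "step n F = 1" by (rule step_one[OF w])
  then have "F \<in> half n" by (intro step_in_half[OF w]) simp
  then have FL: "F \<in> set (chain_list (half n))" using L(2) by simp
  show ?thesis
    unfolding g(1)
  proof (rule flow_start[OF L(1) _ FL, where s = "step n", OF _ F])
    fix G assume "G \<in> set (chain_list (half n))"
    from g(2)[OF this] show "G \<in> N \<and> 0 \<le> step n G \<and> step n G \<le> 1 \<and> x \<in> \<Inter>G \<and> x' \<in> \<Inter>G"
      using assms(2,3) by (meson subsetD)
  qed
qed

text \<open>Every family in \<open>half n\<close> contains the support of the core, so each
  contraction that runs keeps the point inside all members of the core. This is the common witness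
  used later for the round trip on the nerve.\<close>

lemma glide_in:
  assumes n: "n \<in> realization_set N" and x: "x \<in> \<Inter>(spt n)"
  shows "glide (step n) x \<in> \<Inter>(spt (core n))"
proof -
  note w = weight_nerve[OF n]
  note L = chain_list_half[OF w]
  note g = glide_half[OF n, of "step n" 1, simplified]
  have "spt (core n) \<subseteq> F" if "F \<in> half n" for F
    using core_spt_subset[OF w] that by (simp add: half_def)
  note core_sub = this
  show ?thesis
    unfolding g(1)
  proof (rule flow_in[OF L(1)])
    fix G assume G: "G \<in> set (chain_list (half n))"
    from g(2)[OF G] show "G \<in> N \<and> 0 \<le> step n G \<and> step n G \<le> 1 \<and> x \<in> \<Inter>G"
      using x by (meson subsetD)
    show "\<Inter>G \<subseteq> \<Inter>(spt (core n))" using core_sub[of G] G L(2) by (intro Inter_anti_mono) simp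
  qed (use x weight_core(2)[OF w] in blast)
qed

text \<open>On the closed set where a given chain \<open>c0\<close> contains all the active steps, the composition runs along
  \<open>c0\<close>; only finitely many such sets are needed.\<close>

lemma glide_continuous:
  assumes n: "fin_family Y A n" "\<And>y. y \<in> topspace Y \<Longrightarrow> n y \<in> realization_set N"
    and c: "continuous_map Y euclideanreal c" "\<And>y. y \<in> topspace Y \<Longrightarrow> 0 \<le> c y \<and> c y \<le> 1"
    and p: "\<And>y. y \<in> topspace Y \<Longrightarrow> p y \<in> \<Inter>(spt (n y))"
    and alt: "continuous_map Y T p \<or> (\<forall>y. c y = 1)"
  shows "continuous_map Y T (\<lambda>y. glide (\<lambda>F. c y * step (n y) F) (p y))"
proof -
  let ?s = "\<lambda>y F. c y * step (n y) F"
  note sdf = fin_family_sd[OF n(1)]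
  \<comment> \<open>For \<open>F\<close> in \<open>c0\<close> the first condition keeps
    \<open>F\<close> inside \<open>spt (n y)\<close>, so \<open>p y\<close> lies in the domain of
    its contraction; the second condition makes every family outside \<open>c0\<close> inactive.
    Families not contained in \<open>Pow A\<close> have \<open>sd\<close> zero on
    \<open>Y\<close>.\<close>
  define Z where "Z c0 = topspace Y \<inter>
      ((\<Inter>F\<in>c0. {y \<in> topspace Y. 2 * sd (n y) F - mx (sd (n y)) UNIV \<in> {0..}}) \<inter>
       (\<Inter>F\<in>Pow A - c0. {y \<in> topspace Y. 2 * sd (n y) F - mx (sd (n y)) UNIV \<in> {..0}}))" for c0
  have in_Z: "y \<in> Z c0 \<longleftrightarrow> y \<in> topspace Y \<and> c0 \<subseteq> half (n y) \<and>
      (\<forall>F\<in>Pow A - c0. 2 * sd (n y) F \<le> mx (sd (n y)) UNIV)" for y c0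
    by (auto simp: Z_def half_def)
  have half_Pow: "half (n y) \<subseteq> Pow A" if "y \<in> topspace Y" for y
    by (rule order_trans[OF half_subset[OF weight_nerve[OF n(2)[OF that]]]])
      (use sdf that in \<open>simp add: fin_family_def\<close>)
  have active: "F \<in> c0" if y: "y \<in> Z c0" and F: "step (n y) F \<noteq> 0" for y F c0
  proof (rule ccontr)
    assume "F \<notin> c0"
    have yY: "y \<in> topspace Y" using y by (simp add: in_Z)
    note w = weight_nerve[OF n(2)[OF yY]]
    have "F \<in> Pow A - c0" using step_in_half[OF w F] half_Pow[OF yY] \<open>F \<notin> c0\<close> by blast
    then have "2 * sd (n y) F \<le> mx (sd (n y)) UNIV" using y unfolding in_Z by blast
    then show False using F by (simp add: step_nonzero[OF w])
  qed
  have cl: "closedin Y (Z c0)" for c0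
  proof -
    have *: "continuous_map Y euclideanreal (\<lambda>y. 2 * sd (n y) F - mx (sd (n y)) UNIV)" for F
      using sdf fin_family_mx[OF sdf]
      by (intro continuous_map_diff continuous_map_real_mult) (auto simp: fin_family_def)
    have "Z c0 = \<Inter>(insert (topspace Y) ((\<lambda>F. {y \<in> topspace Y. 2 * sd (n y) F - mx (sd (n y)) UNIV \<in> {0..}}) ` c0 \<union>
        (\<lambda>F. {y \<in> topspace Y. 2 * sd (n y) F - mx (sd (n y)) UNIV \<in> {..0}}) ` (Pow A - c0)))"
      by (auto simp: Z_def)
    also have "closedin Y \<dots>"
      by (intro closedin_Inter) (auto intro!: closedin_continuous_map_preimage[OF *, of "{0..}", simplified]
          closedin_continuous_map_preimage[OF *, of "{..0}", simplified])
    finally show ?thesis .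
  qed
  have cont: "continuous_map (subtopology Y (Z c0)) T (\<lambda>y. glide (?s y) (p y))" for c0
  proof (cases "Z c0 = {}")
    case True
    then show ?thesis by (simp add: continuous_map_def)
  next
    case False
    \<comment> \<open>A single point of the piece shows that \<open>c0\<close>, being part of
      \<open>half (n y0)\<close>, is a finite chain of simplices of the nerve; indices without such
      a point give empty pieces.\<close>
    then obtain y0 where y0: "y0 \<in> Z c0" by blast
    have n0: "n y0 \<in> realization_set N" using y0 n(2) by (simp add: in_Z)
    note w0 = weight_nerve[OF n0]
    have h0: "c0 \<subseteq> half (n y0)" using y0 by (simp add: in_Z)
    have fin0: "finite c0" using h0 finite_half[OF w0] finite_subset by blast
    have L: "sorted_wrt (\<subset>) (chain_list c0)" "set (chain_list c0) = c0"
      using fin0 half_chain[OF w0] h0 by (intro chain_list; blast)+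
    have rng: "0 \<le> ?s y F \<and> ?s y F \<le> 1 \<and> \<Inter>(spt (n y)) \<subseteq> \<Inter>F" if "y \<in> Z c0" "F \<in> c0" for y F
    proof -
      have y: "y \<in> topspace Y" "F \<in> half (n y)" using that by (auto simp: in_Z)
      note w = weight_nerve[OF n(2)[OF y(1)]]
      show ?thesis
        using step_range[OF w, of F] c(2)[OF y(1)] Inter_anti_mono[OF half_subset_spt[OF w y(2)]]
        by (simp add: mult_le_one)
    qed
    have eq: "glide (?s y) (p y) = flow (chain_list c0) (?s y) (p y)" if y: "y \<in> Z c0" for y
    proof (rule glide_eq_flow[OF L(1)])
      show "{F. ?s y F \<noteq> 0} \<subseteq> set (chain_list c0)" using L(2) active[OF y] by auto
    qed
    have conts: "continuous_map (subtopology Y (Z c0)) T (\<lambda>y. flow (chain_list c0) (?s y) (q y))"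
      if "continuous_map (subtopology Y (Z c0)) T q" "\<And>y F. y \<in> Z c0 \<Longrightarrow> F \<in> c0 \<Longrightarrow> q y \<in> \<Inter>F" for q
    proof (rule flow_continuous[OF L(1) that(1)])
      fix F assume F: "F \<in> set (chain_list c0)"
      show "F \<in> N \<and> continuous_map (subtopology Y (Z c0)) euclideanreal (\<lambda>y. ?s y F)"
        using F L(2) h0 half_in_nerve[OF n0] fin_family_step[OF n(1)] c(1)
        by (auto intro!: continuous_map_real_mult continuous_map_from_subtopology)
      fix y assume "y \<in> topspace (subtopology Y (Z c0))"
      then show "0 \<le> ?s y F \<and> ?s y F \<le> 1 \<and> q y \<in> \<Inter>F"
        using rng[of y F] that(2)[of y F] F L(2) by simp
    qed
    have pF: "p y \<in> \<Inter>F" if "y \<in> Z c0" "F \<in> c0" for y F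
      using rng[OF that] p[of y] that(1) by (auto simp: in_Z)
    show ?thesis
    proof (cases "continuous_map Y T p")
      case True
      show ?thesis
        by (rule continuous_map_eq[OF conts[OF continuous_map_from_subtopology[OF True] pF]])
          (auto simp: eq)
    next
      case False
      \<comment> \<open>Here \<open>p\<close> may be discontinuous, but the factor is 1, so some
        step in \<open>c0\<close> is full and \<open>p y\<close> can be replaced by the constant
        \<open>p y0\<close>. That point lies in every intersection along \<open>c0\<close> because
        \<open>y0\<close> belongs to the same piece.\<close>
      then have c1: "c y = 1" for y using alt by blast
      have p0: "p y0 \<in> topspace T"
        using p[of y0] y0 in_topspace[of "spt (n y0)" "p y0"] n0
        by (auto simp: in_Z in_realization_set)
      have "flow (chain_list c0) (?s y) (p y0) = glide (?s y) (p y)" if y: "y \<in> Z c0" for y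
      proof -
        have yY: "y \<in> topspace Y" using y by (simp add: in_Z)
        note w = weight_nerve[OF n(2)[OF yY]]
        obtain F where F: "step (n y) F = 1" by (rule step_one[OF w])
        then have "F \<in> c0" using active[OF y] by simp
        show ?thesis
          unfolding eq[OF y]
        proof (intro flow_start[OF L(1)])
          fix G assume "G \<in> set (chain_list c0)"
          then have G: "G \<in> c0" using L(2) by simp
          moreover have "G \<in> N" using G h0 half_in_nerve[OF n0] by blast
          ultimately show "G \<in> N \<and> 0 \<le> ?s y G \<and> ?s y G \<le> 1 \<and> p y0 \<in> \<Inter>G \<and> p y \<in> \<Inter>G"
            using rng[OF y G] pF[OF y G] pF[OF y0 G] by blast
        qed (use L(2) F c1 \<open>F \<in> c0\<close> in auto)
      qed
      moreover have "continuous_map (subtopology Y (Z c0)) T (\<lambda>y. flow (chain_list c0) (?s y) (p y0))"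
        by (rule conts) (use p0 pF[OF y0] in simp_all)
      ultimately show ?thesis by (rule continuous_map_eq[rotated]) simp
    qed
  qed
  show ?thesis
  proof (rule pasting_lemma_closed[where I = "Pow (Pow A)" and T = Z and f = "\<lambda>_ y. glide (?s y) (p y)"])
    show "finite (Pow (Pow A))" using n(1) by (simp add: fin_family_def)
    fix y assume y: "y \<in> topspace Y"
    \<comment> \<open>The pieces cover \<open>Y\<close>: families outside \<open>half (n y)\<close>
      satisfy the second condition strictly.\<close>
    then have "y \<in> Z (half (n y))" by (auto simp: in_Z half_def)
    then show "\<exists>j. j \<in> Pow (Pow A) \<and> y \<in> Z j \<and> glide (?s y) (p y) = glide (?s y) (p y)"
      using half_Pow[OF y] by blast
  qed (simp_all add: cl cont)
qed

lemma homotopy_equivalent_nerve: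
  assumes f: "loc_fin_family T f"
    "\<And>x. x \<in> topspace T \<Longrightarrow> f x \<in> realization_set N"
    "\<And>x. x \<in> topspace T \<Longrightarrow> x \<in> \<Inter>(spt (f x))"
  shows "T homotopy_equivalent_space realization N"
proof -
  have K: "is_complex N" by (simp add: nerve_def is_complex_dowker)
  define g where "g n = glide (step n) (SOME x. x \<in> \<Inter>(spt n))" for n
  have start: "(SOME x. x \<in> \<Inter>(spt n)) \<in> \<Inter>(spt n)" if n: "n \<in> realization_set N" for n
  proof -
    have "spt n \<in> N" using n by (simp add: in_realization_set)
    then have "\<exists>x. x \<in> \<Inter>(spt n)" by (auto simp: nerve_def dowker_def)
    then show ?thesis by (rule someI_ex)
  qed
  have g_simplex: "continuous_map (top_of_set (closed_simplex N \<sigma>)) T g" if s: "\<sigma> \<in> N" for \<sigma>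
  proof -
    \<comment> \<open>The start picked by \<open>SOME\<close> need not vary continuously with
      \<open>n\<close>; the constant factor 1 selects the alternative of
      \<open>glide_continuous\<close> in which the start is forgotten.\<close>
    have "continuous_map (top_of_set (closed_simplex N \<sigma>)) T
        (\<lambda>n. glide (\<lambda>F. 1 * step n F) (SOME x. x \<in> \<Inter>(spt n)))"
      by (rule glide_continuous[OF fin_family_simplex[OF K s]])
        (use start in \<open>simp_all add: in_closed_simplex\<close>)
    then show ?thesis by (simp add: g_def[abs_def])
  qed
  have f_cont: "continuous_map T (realization N) f"
    by (rule continuous_map_into_realization[OF f(1,2)])
  have g_cont: "continuous_map (realization N) T g"
    by (rule continuous_map_from_realization[OF g_simplex])
  have "homotopic_with (\<lambda>_. True) T T id (g \<circ> f)"
  proof -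
    let ?P = "prod_topology unit_interval T"
    let ?h = "\<lambda>p. glide (\<lambda>F. fst p * step (f (snd p)) F) (snd p)"
    have "continuous_map ?P T ?h"
    proof (rule continuous_map_locally)
      fix p assume p: "p \<in> topspace ?P"
      have "loc_fin_family ?P (\<lambda>p. f (snd p))"
        by (rule loc_fin_family_comp[OF f(1) continuous_map_snd])
      then obtain V A where V: "openin ?P V" "p \<in> V" "fin_family (subtopology ?P V) A (\<lambda>p. f (snd p))"
        using p unfolding loc_fin_family_def by blast
      have "continuous_map ?P euclideanreal fst"
        by (rule continuous_map_into_fulltopology[OF continuous_map_fst])
      then have "continuous_map (subtopology ?P V) T ?h"
        by (intro glide_continuous[OF V(3)] continuous_map_from_subtopology disjI1 continuous_map_snd)
          (use f in auto)
      then show "\<exists>V. openin ?P V \<and> p \<in> V \<and> continuous_map (subtopology ?P V) T ?h"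
        using V by blast
    qed
    moreover have "?h (0, x) = id x" for x
      using glide_eq_flow[of "[]" "\<lambda>_. 0" x] by simp
    moreover have "?h (1, x) = (g \<circ> f) x" if "x \<in> topspace T" for x
      using glide_start[OF f(2) f(3) start[OF f(2)]] that by (simp add: g_def)
    ultimately show ?thesis
      by (subst homotopic_with) (rule refl, intro exI[of _ ?h] conjI ballI, auto)
  qed
  moreover have "homotopic_with (\<lambda>_. True) (realization N) (realization N) (f \<circ> g) id"
  proof (rule homotopic_id_core[OF K])
    show "\<sigma> \<in> N \<Longrightarrow> \<tau> \<subseteq> \<sigma> \<Longrightarrow> \<tau> \<noteq> {} \<Longrightarrow> \<tau> \<in> N" for \<sigma> \<tau>
      unfolding nerve_def by (rule dowker_face)
    show "loc_fin_family (top_of_set (closed_simplex N \<sigma>)) (f \<circ> g)" if "\<sigma> \<in> N" for \<sigma>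
      unfolding o_def by (rule loc_fin_family_comp[OF f(1) g_simplex[OF that]])
    fix n assume n: "n \<in> realization_set N"
    have gT: "g n \<in> topspace T" using g_cont n by (auto simp: continuous_map_def)
    then show fg: "(f \<circ> g) n \<in> realization_set N" using f(2) by simp
    have w: "weight n" by (rule weight_nerve[OF n])
    have "spt n \<in> N" "spt (f (g n)) \<in> N" using n fg by (simp_all add: in_realization_set)
    \<comment> \<open>The point \<open>g n\<close> lies in all members of the core and in all
      vertices of its own image, so it witnesses that together they span a simplex.\<close>
    moreover have "g n \<in> \<Inter>(spt (core n))"
      unfolding g_def by (rule glide_in[OF n start[OF n]])
    moreover have "g n \<in> \<Inter>(spt (f (g n)))" by (rule f(3)[OF gT])
    ultimately show "spt (core n) \<union> spt ((f \<circ> g) n) \<in> N"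
      using weight_core[OF w] gT by (auto simp: nerve_def dowker_def weight_def)
  qed
  ultimately show ?thesis
    unfolding homotopy_equivalent_space_def using f_cont g_cont homotopic_with_symD by blast
qed

end

section \<open>Contractions and nerve map from a good numerable cover\<close>

lemma good_cover_contractible_cover:
  assumes "good_cover T \<U>" obtains h pt where "contractible_cover T \<U> h pt"
proof -
  have sub: "U \<subseteq> topspace T" if "U \<in> \<U>" for U
    using assms that by (auto simp: good_cover_def is_cover_def)
  have "\<exists>h p. continuous_map (prod_topology unit_interval (subtopology T (\<Inter>F))) (subtopology T (\<Inter>F)) h \<and>
      (\<forall>x\<in>\<Inter>F. h (0, x) = x \<and> h (1, x) = p)" if F: "F \<in> nerve T \<U>" for F
  proof -
    have F': "finite F" "F \<noteq> {}" "F \<subseteq> \<U>" "\<Inter>F \<noteq> {}"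
      using F by (auto simp: nerve_def dowker_def)
    then have "contractible_space (subtopology T (\<Inter>F))"
      using assms by (auto simp: good_cover_def)
    then obtain p where "homotopic_with (\<lambda>_. True) (subtopology T (\<Inter>F)) (subtopology T (\<Inter>F)) id (\<lambda>_. p)"
      by (auto simp: contractible_space_def)
    then show ?thesis unfolding homotopic_with_def by (auto 4 3)
  qed
  then obtain h pt where "\<And>F. F \<in> nerve T \<U> \<Longrightarrow>
      continuous_map (prod_topology unit_interval (subtopology T (\<Inter>F))) (subtopology T (\<Inter>F)) (h F) \<and>
      (\<forall>x\<in>\<Inter>F. h F (0, x) = x \<and> h F (1, x) = pt F)"
    by metis
  then have "contractible_cover T \<U> h pt"
    by unfold_locales (use sub in blast)+
  then show ?thesis by (rule that)
qed

text \<open>Each function is sent to a chosen member containing its support; \<open>push e\<close>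
  merges the functions with the same choice, and normalising restores total weight 1. Since supports
  are closures of nonvanishing sets, \<open>x\<close> lies in every vertex of \<open>f x\<close> and
  witnesses the simplex.\<close>

lemma numerable_cover_nerve_map:
  assumes "numerable_cover T \<U>"
  obtains f where "loc_fin_family T f"
    "\<And>x. x \<in> topspace T \<Longrightarrow> f x \<in> realization_set (nerve T \<U>)"
    "\<And>x. x \<in> topspace T \<Longrightarrow> x \<in> \<Inter>(spt (f x))"
proof -
  obtain \<Phi> where
    \<Phi>: "\<forall>\<phi>\<in>\<Phi>. continuous_map T euclideanreal \<phi> \<and> (\<forall>x\<in>topspace T. 0 \<le> \<phi> x \<and> \<phi> x \<le> 1)" and
    locfin: "\<forall>x\<in>topspace T. \<exists>V. openin T V \<and> x \<in> V \<and> finite {\<phi>\<in>\<Phi>. \<exists>y\<in>V. \<phi> y \<noteq> 0}" and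
    sum1: "\<forall>x\<in>topspace T. (\<Sum>\<phi>\<in>{\<phi>\<in>\<Phi>. \<phi> x \<noteq> 0}. \<phi> x) = 1" and
    supp: "\<forall>\<phi>\<in>\<Phi>. \<exists>U\<in>\<U>. fsupport T \<phi> \<subseteq> U"
    using assms unfolding numerable_cover_def by (elim conjE exE) (rule that)
  have cont: "continuous_map T euclideanreal \<phi>" if "\<phi> \<in> \<Phi>" for \<phi> using \<Phi> that by blast
  have nonneg: "0 \<le> \<phi> x" if "\<phi> \<in> \<Phi>" "x \<in> topspace T" for \<phi> x using \<Phi> that by blast
  obtain e where e: "\<And>\<phi>. \<phi> \<in> \<Phi> \<Longrightarrow> e \<phi> \<in> \<U> \<and> fsupport T \<phi> \<subseteq> e \<phi>"
    using supp by metis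
  \<comment> \<open>A weight is a function on the whole type of indices, so it is extended by 0
    outside the partition.\<close>
  define b where "b x \<phi> = (if \<phi> \<in> \<Phi> then \<phi> x else 0)" for x :: 'a and \<phi>
  have spt_b: "spt (b x) = {\<phi> \<in> \<Phi>. \<phi> x \<noteq> 0}" for x by (auto simp: spt_def b_def)
  have b_fam: "loc_fin_family T b"
    unfolding loc_fin_family_def
  proof
    fix x assume "x \<in> topspace T"
    then obtain V where V: "openin T V" "x \<in> V" "finite {\<phi>\<in>\<Phi>. \<exists>y\<in>V. \<phi> y \<noteq> 0}"
      using locfin by blast
    have "fin_family (subtopology T V) {\<phi>\<in>\<Phi>. \<exists>y\<in>V. \<phi> y \<noteq> 0} b"
      unfolding fin_family_def
    proof (intro conjI allI ballI V(3))
      show "continuous_map (subtopology T V) euclideanreal (\<lambda>y. b y \<phi>)" for \<phi>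
        by (cases "\<phi> \<in> \<Phi>") (simp_all add: b_def cont continuous_map_from_subtopology)
      fix y assume "y \<in> topspace (subtopology T V)"
      then have y: "y \<in> topspace T" "y \<in> V" by auto
      show sub: "spt (b y) \<subseteq> {\<phi>\<in>\<Phi>. \<exists>y\<in>V. \<phi> y \<noteq> 0}" using y by (auto simp: spt_b)
      have "spt (b y) \<noteq> {}" using bspec[OF sum1 y(1)] unfolding spt_b by (metis sum.empty zero_neq_one)
      then show "weight (b y)"
        using finite_subset[OF sub V(3)] nonneg y(1) by (simp add: weight_def b_def)
    qed
    then show "\<exists>V A. openin T V \<and> x \<in> V \<and> fin_family (subtopology T V) A b" using V by blast
  qed
  have b_weight: "weight (b x)" if "x \<in> topspace T" for x
    using b_fam that unfolding loc_fin_family_def fin_family_def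
    by (metis IntI topspace_subtopology)
  define f where "f x = normalise (push e (b x))" for x
  have spt_f: "spt (f x) = e ` {\<phi> \<in> \<Phi>. \<phi> x \<noteq> 0}" if "x \<in> topspace T" for x
    using b_weight[OF that] by (simp add: f_def normalise_spt weight_push push_spt spt_b)
  have mem: "x \<in> \<Inter>(spt (f x))" if x: "x \<in> topspace T" for x
  proof -
    have "x \<in> e \<phi>" if "\<phi> \<in> \<Phi>" "\<phi> x \<noteq> 0" for \<phi>
    proof -
      have "x \<in> fsupport T \<phi>"
        unfolding fsupport_def using x that by (intro subsetD[OF closure_of_subset]) auto
      then show ?thesis using e[OF that(1)] by blast
    qed
    then show ?thesis by (auto simp: spt_f[OF x])
  qed
  have push_weight: "weight (push e (b x))" if "x \<in> topspace T" for x
    by (rule weight_push[OF b_weight[OF that]])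
  show ?thesis
  proof (rule that)
    show "loc_fin_family T f"
      unfolding loc_fin_family_def f_def
    proof
      fix x assume "x \<in> topspace T"
      then obtain V A where V: "openin T V" "x \<in> V" "fin_family (subtopology T V) A b"
        using b_fam unfolding loc_fin_family_def by blast
      then show "\<exists>V A. openin T V \<and> x \<in> V \<and> fin_family (subtopology T V) A (\<lambda>x. normalise (push e (b x)))"
        using fin_family_normalise[OF fin_family_push[OF V(3), of e]] by blast
    qed
    fix x assume x: "x \<in> topspace T"
    show "x \<in> \<Inter>(spt (f x))" by (rule mem[OF x])
    have "spt (push e (b x)) = spt (f x)" by (simp add: f_def normalise_spt push_weight[OF x])
    moreover have "spt (f x) \<in> nerve T \<U>"
      unfolding nerve_def dowker_def
    proof (intro CollectI conjI bexI[of _ x] ballI x)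
      show "finite (spt (f x))" "spt (f x) \<noteq> {}"
        using weight_normalise[OF push_weight[OF x]] by (simp_all add: f_def weight_def)
      show "spt (f x) \<subseteq> \<U>" using e by (auto simp: spt_f[OF x])
      show "x \<in> U" if "U \<in> spt (f x)" for U using mem[OF x] that by blast
    qed
    ultimately show "f x \<in> realization_set (nerve T \<U>)"
      unfolding f_def using push_weight[OF x] by (intro normalise_in_realization) (simp_all add: f_def)
  qed
qed

theorem nerve_theorem:
  assumes "good_cover T \<U>" "numerable_cover T \<U>"
  shows "T homotopy_equivalent_space realization (nerve T \<U>)"
proof -
  obtain h pt where "contractible_cover T \<U> h pt" by (rule good_cover_contractible_cover[OF assms(1)])
  then interpret contractible_cover T \<U> h pt .
  show ?thesis
    by (rule numerable_cover_nerve_map[OF assms(2)]) (rule homotopy_equivalent_nerve)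
qed

section \<open>Vietoris--Rips complexes\<close>

text \<open>The complex is left abstract so that the strict and the weak diameter bound are both
  instances: each enters only by deciding which finite sets lie in a member of the cover.\<close>

corollary vietoris_homotopy_equivalent:
  assumes "good_cover T \<U>" "numerable_cover T \<U>"
    and K: "\<And>\<sigma>. \<sigma> \<in> K \<longleftrightarrow> finite \<sigma> \<and> \<sigma> \<noteq> {} \<and> \<sigma> \<subseteq> topspace T \<and> (\<exists>U\<in>\<U>. \<sigma> \<subseteq> U)"
  shows "realization K homotopy_equivalent_space T"
proof -
  have "K = dowker (topspace T) \<U> (\<lambda>x U. x \<in> U)"
    by (rule set_eqI) (simp add: K dowker_def subset_eq)
  then have "realization K homotopy_equivalent_space realization (nerve T \<U>)"
    using dowker_duality[of "topspace T" \<U> "\<lambda>x U. x \<in> U"] by (simp add: nerve_def)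
  moreover have "realization (nerve T \<U>) homotopy_equivalent_space T"
    using nerve_theorem[OF assms(1,2)] homotopy_equivalent_space_sym by blast
  ultimately show ?thesis by (rule homotopy_eqv_trans)
qed

theorem mainTheorem3:
  fixes M :: "'a set" and d :: "'a \<Rightarrow> 'a \<Rightarrow> real" and r :: real
  assumes "Metric_space M d" and "r > 0"
  shows "(\<forall>\<U>. good_cover (Metric_space.mtopology M d) \<U> \<and>
               numerable_cover (Metric_space.mtopology M d) \<U> \<and>
               (\<forall>\<sigma>. finite \<sigma> \<and> \<sigma> \<noteq> {} \<and> \<sigma> \<subseteq> M \<longrightarrow>
                    ((\<exists>U\<in>\<U>. \<sigma> \<subseteq> U) \<longleftrightarrow> fdiam d \<sigma> < r))
           \<longrightarrow> realization (Rips M d r) homotopy_equivalent_space Metric_space.mtopology M d)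
       \<and> (\<forall>\<U>. good_cover (Metric_space.mtopology M d) \<U> \<and>
               numerable_cover (Metric_space.mtopology M d) \<U> \<and>
               (\<forall>\<sigma>. finite \<sigma> \<and> \<sigma> \<noteq> {} \<and> \<sigma> \<subseteq> M \<longrightarrow>
                    ((\<exists>U\<in>\<U>. \<sigma> \<subseteq> U) \<longleftrightarrow> fdiam d \<sigma> \<le> r))
           \<longrightarrow> realization (closed_Rips M d r) homotopy_equivalent_space Metric_space.mtopology M d)"
proof -
  interpret Metric_space M d by fact
  show ?thesis
    by (intro conjI allI impI; elim conjE; rule vietoris_homotopy_equivalent)
      (auto simp: Rips_def closed_Rips_def)
qed

end
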